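(* Let $\mathbb{L}=(\mathcal{P},\mathcal{C},\parallel)$ be a Laguerre plane satisfying axioms (C) and (S), and let $K,L$ be circles which are not tangent. Then there exists an involutory automorphism $\phi$ of $\mathbb{L}$ such that (1) $\phi(x)=xKL$ for all $x\in K$; and (2) for every point $x$ with $\phi(x)\neq x$ and every circle $M$ containing both $x$ and $\phi(x)$, we have $\phi(M)=M$.
   Context: A Laguerre plane is a triple $(\mathcal{P},\mathcal{C},\parallel)$ where $\mathcal{P}$ is a set of points, $\mathcal{C}\subset 2^{\mathcal{P}}$ a set of circles and $\parallel$ an equivalence relation on $\mathcal{P}$ (parallelism; its classes are called generators) such that: (1) any three pairwise non-parallel points lie on a unique circle; (2) for every circle $K$ and non-parallel points $p\in K$, $q\notin K$ there is exactly one circle $L$ with $q\in L$ and $K\cap L=\{p\}$; (3) for every point $p$ and circle $K$ there is exactly one point $q\in K$ with $q\parallel p$; (4) some circle contains at least three but not all points. Circles $K,L$ are tangent at $p$ if $K\cap L=\{p\}$ or $K=L$ (with $p\in K$); they are tangent if tangent at some point. For $p\in K$, $\langle p,K\rangle$ denotes the set of circles tangent to $K$ at $p$. Axiom (C): for any circles $K,L$ and any point $p\in K\setminus L$ there exists exactly one circle $M\in\langle p,K\rangle$ with $|M\cap L|=1$. Axiom (S): if $K,L,M,N$ are circles and $a,b,c,d$ points with $K\cap L=\{a\}$, $L\cap M=\{b\}$, $M\cap N=\{c\}$, $N\cap K=\{d\}$ and $a\nparallel c$, then there is a circle containing $a,b,c,d$. Notation: for distinct circles $K,L$ and $x\in K\setminus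 L$, let $M$ be the unique circle of $\langle x,K\rangle$ with $|M\cap L|=1$ given by (C); then $xKL$ denotes the unique point of $M\cap L$. For $x\in K\cap L$, $xKL:=x$. An automorphism of $\mathbb{L}$ is a bijection of $\mathcal{P}$ mapping the set of circles onto itself; it is involutory if its square is the identity. *)

theory Defs
  imports Main
begin

definition laguerre_plane :: "'p set \<Rightarrow> 'p set set \<Rightarrow> ('p \<Rightarrow> 'p \<Rightarrow> bool) \<Rightarrow> bool" where
  "laguerre_plane P C par \<longleftrightarrow>
     (\<forall>K\<in>C. K \<subseteq> P) \<and>
     (\<forall>x\<in>P. par x x) \<and>
     (\<forall>x\<in>P. \<forall>y\<in>P. par x y \<longrightarrow> par y x) \<and>
     (\<forall>x\<in>P. \<forall>y\<in>P. \<forall>z\<in>P. par x y \<longrightarrow> par y z \<longrightarrow> par x z) \<and>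
     (\<forall>p\<in>P. \<forall>q\<in>P. \<forall>r\<in>P. \<not> par p q \<and> \<not> par q r \<and> \<not> par p r \<longrightarrow>
        (\<exists>!K. K \<in> C \<and> p \<in> K \<and> q \<in> K \<and> r \<in> K)) \<and>
     (\<forall>K\<in>C. \<forall>p\<in>K. \<forall>q\<in>P - K. \<not> par p q \<longrightarrow>
        (\<exists>!L. L \<in> C \<and> q \<in> L \<and> K \<inter> L = {p})) \<and>
     (\<forall>p\<in>P. \<forall>K\<in>C. \<exists>!q. q \<in> K \<and> par q p) \<and>
     (\<exists>K\<in>C. (\<exists>a b c. a \<in> K \<and> b \<in> K \<and> c \<in> K \<and> a \<noteq> b \<and> b \<noteq> c \<and> a \<noteq> c) \<and> K \<noteq> P)"

definition tangent_at :: "'p set \<Rightarrow> 'p set \<Rightarrow> 'p \<Rightarrow> bool" where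
  "tangent_at K L p \<longleftrightarrow> K \<inter> L = {p} \<or> (K = L \<and> p \<in> K)"

definition tangent :: "'p set \<Rightarrow> 'p set \<Rightarrow> bool" where
  "tangent K L \<longleftrightarrow> (\<exists>p. tangent_at K L p)"

definition pencil :: "'p set set \<Rightarrow> 'p \<Rightarrow> 'p set \<Rightarrow> 'p set set" where
  "pencil C p K = {M \<in> C. tangent_at M K p}"

definition axiom_C :: "'p set \<Rightarrow> 'p set set \<Rightarrow> bool" where
  "axiom_C P C \<longleftrightarrow> (\<forall>K\<in>C. \<forall>L\<in>C. \<forall>p \<in> K - L.
      \<exists>!M. M \<in> pencil C p K \<and> card (M \<inter> L) = 1)"

definition axiom_S :: "'p set \<Rightarrow> 'p set set \<Rightarrow> ('p \<Rightarrow> 'p \<Rightarrow> bool) \<Rightarrow> bool" where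
  "axiom_S P C par \<longleftrightarrow> (\<forall>K\<in>C. \<forall>L\<in>C. \<forall>M\<in>C. \<forall>N\<in>C. \<forall>a b c d.
      K \<inter> L = {a} \<and> L \<inter> M = {b} \<and> M \<inter> N = {c} \<and> N \<inter> K = {d} \<and> \<not> par a c
      \<longrightarrow> (\<exists>Z\<in>C. a \<in> Z \<and> b \<in> Z \<and> c \<in> Z \<and> d \<in> Z))"

definition xKL :: "'p set set \<Rightarrow> 'p \<Rightarrow> 'p set \<Rightarrow> 'p set \<Rightarrow> 'p" where
  "xKL C x K L =
     (if x \<in> L then x
      else (let M = (THE M. M \<in> pencil C x K \<and> card (M \<inter> L) = 1)
            in THE y. M \<inter> L = {y}))"

definition automorphism :: "'p set \<Rightarrow> 'p set set \<Rightarrow> ('p \<Rightarrow> 'p) \<Rightarrow> bool" where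
  "automorphism P C \<phi> \<longleftrightarrow> bij_betw \<phi> P P \<and> (\<lambda>M. \<phi> ` M) ` C = C"

definition involutory :: "'p set \<Rightarrow> ('p \<Rightarrow> 'p) \<Rightarrow> bool" where
  "involutory P \<phi> \<longleftrightarrow> (\<forall>x\<in>P. \<phi> (\<phi> x) = x)"

end

theory Submission
  imports Defs
begin

text \<open>In the classical model circles are quadratic polynomials, and two of them touch when their
  difference has a double root.  Call \<open>K\<close> and \<open>L\<close> related by a pair of generators \<open>g\<close>, \<open>h\<close> when
  some circle touches \<open>K\<close> on \<open>g\<close> and \<open>L\<close> on \<open>h\<close>.  Axioms (C) and (S) make this relation symmetric in
  \<open>g\<close>, \<open>h\<close> and an equivalence relation on circles.  Transitivity yields, for every circle \<open>V\<close>, a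
  commuting and transitive family of maps on a generator, built from the circles meeting \<open>V\<close> in
  two prescribed points; this replaces the multiplicative group of the coordinate field and shows
  that two such maps agreeing at one point agree everywhere.

  For non-tangent \<open>K\<close>, \<open>L\<close> the map \<open>x \<mapsto> xKL\<close> induces an involution of the generators.  A point \<open>x\<close> on
  a generator moved by it is sent to the second point, on the image generator, of the circle through
  \<open>x\<close>, \<open>k\<close> and \<open>kKL\<close>; the agreement principle makes this independent of \<open>k \<in> K\<close>.  If only one pair of
  generators is moved, the plane has four generators with three points each, and a parity argument
  on permutations of three points replaces the general one.\<close>

section \<open>Points, circles and tangency\<close>

text \<open>In the model a circle \<open>Z\<close> meeting \<open>V\<close> over \<open>k\<close>
  and \<open>l\<close> satisfies Z - V = \<alpha> (X - k)(X - l), so passing along such circles from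
  one generator to another multiplies the height above \<open>V\<close> by a product of two factors,
  one for \<open>k\<close> and one for \<open>l\<close>. This is the origin of the symmetric,
  commuting family of maps; (C) and (S) have to reproduce it without coordinates. The obstacle is
  that the circle touching \<open>K\<close> and \<open>L\<close> on the generators of
  \<open>k\<close> and \<open>kKL\<close> changes with \<open>k\<close>, so the maps for different
  \<open>k\<close> start out over different base circles. They are moved to one base circle
  \<open>V\<close>, which touches \<open>K\<close> and \<open>L\<close> on the generators of
  \<open>x\<close> and of its image. Over \<open>V\<close> every choice of \<open>k\<close> sends
  the point of \<open>L\<close> on the generator of \<open>x\<close> to the point of
  \<open>K\<close> on the image generator, and this common value starts the agreement principle.
  With a single moved pair there is no moved \<open>k\<close> off the generators of \<open>x\<close>
  and of its image, so that definition has no input.\<close>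

locale laguerre_CS =
  fixes P :: "'p set" and C :: "'p set set" and par :: "'p \<Rightarrow> 'p \<Rightarrow> bool"
  assumes lag: "laguerre_plane P C par"
    and axC: "axiom_C P C"
    and axS: "axiom_S P C par"
begin

text \<open>\<open>par\<close> is arbitrary outside \<open>P\<close>, so this relation and
  \<open>\<sharp>\<close> carry membership in \<open>P\<close>; carrier side conditions are
  recovered from them by \<open>eqv_P\<close> and \<open>npar_P\<close>.\<close>

definition eqv :: "'p \<Rightarrow> 'p \<Rightarrow> bool" (infix "\<simeq>" 50) where
  "x \<simeq> y \<longleftrightarrow> x \<in> P \<and> y \<in> P \<and> par x y"

definition npar :: "'p \<Rightarrow> 'p \<Rightarrow> bool" (infix "\<sharp>" 50) where
  "x \<sharp> y \<longleftrightarrow> x \<in> P \<and> y \<in> P \<and> \<not> par x y"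

text \<open>Generators are not handled as sets: a generator is named by any of its points, and
  \<open>M \<star> x\<close> is where \<open>M\<close> crosses the generator of \<open>x\<close>.
  \<open>pt_cong\<close> makes the choice of representative harmless.\<close>

definition pt :: "'p set \<Rightarrow> 'p \<Rightarrow> 'p" (infixl "\<star>" 90) where
  "M \<star> x = (THE q. q \<in> M \<and> par q x)"

lemmas lag_axioms = lag[unfolded laguerre_plane_def]
lemmas ax_sub = lag_axioms[THEN conjunct1]
lemmas ax_refl = lag_axioms[THEN conjunct2, THEN conjunct1]
lemmas ax_sym = lag_axioms[THEN conjunct2, THEN conjunct2, THEN conjunct1]
lemmas ax_trans = lag_axioms[THEN conjunct2, THEN conjunct2, THEN conjunct2, THEN conjunct1]
lemmas ax_join = lag_axioms[THEN conjunct2, THEN conjunct2, THEN conjunct2, THEN conjunct2,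
  THEN conjunct1]
lemmas ax_touch = lag_axioms[THEN conjunct2, THEN conjunct2, THEN conjunct2, THEN conjunct2,
  THEN conjunct2, THEN conjunct1]
lemmas ax_pt = lag_axioms[THEN conjunct2, THEN conjunct2, THEN conjunct2, THEN conjunct2,
  THEN conjunct2, THEN conjunct2, THEN conjunct1]
lemmas ax_rich = lag_axioms[THEN conjunct2, THEN conjunct2, THEN conjunct2, THEN conjunct2,
  THEN conjunct2, THEN conjunct2, THEN conjunct2]

lemma circle_sub: "K \<in> C \<Longrightarrow> x \<in> K \<Longrightarrow> x \<in> P"
  using ax_sub by blast

lemma ex1_imp_eq: "\<exists>!x. Q x \<Longrightarrow> Q a \<Longrightarrow> Q b \<Longrightarrow> a = b"
  by blast

lemma eqv_refl: "x \<in> P \<Longrightarrow> x \<simeq> x"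
  using ax_refl unfolding eqv_def by blast

lemma eqv_sym: "x \<simeq> y \<Longrightarrow> y \<simeq> x"
  using ax_sym unfolding eqv_def by blast

lemma eqv_trans: "x \<simeq> y \<Longrightarrow> y \<simeq> z \<Longrightarrow> x \<simeq> z"
  using ax_trans unfolding eqv_def by meson

lemma npar_sym: "x \<sharp> y \<Longrightarrow> y \<sharp> x"
  using eqv_sym unfolding eqv_def npar_def by blast

lemma npar_cong: "x \<sharp> y \<Longrightarrow> x \<simeq> x' \<Longrightarrow> y \<simeq> y' \<Longrightarrow> x' \<sharp> y'"
  using eqv_sym eqv_trans unfolding eqv_def npar_def by blast

lemma npar_cong1: "x \<sharp> y \<Longrightarrow> x' \<simeq> x \<Longrightarrow> x' \<sharp> y"
  using npar_cong eqv_sym eqv_refl unfolding npar_def by blast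

lemma npar_cong2: "x \<sharp> y \<Longrightarrow> y' \<simeq> y \<Longrightarrow> x \<sharp> y'"
  using npar_cong eqv_sym eqv_refl unfolding npar_def by blast

lemma not_npar_eqv: "x \<sharp> y \<Longrightarrow> x \<simeq> y \<Longrightarrow> False"
  unfolding eqv_def npar_def by blast

lemma eqv_or_npar: "x \<in> P \<Longrightarrow> y \<in> P \<Longrightarrow> x \<simeq> y \<or> x \<sharp> y"
  unfolding eqv_def npar_def by blast

lemma npar_ne: "x \<sharp> y \<Longrightarrow> x \<noteq> y"
  using eqv_refl not_npar_eqv unfolding npar_def by blast

lemma npar_P: "x \<sharp> y \<Longrightarrow> x \<in> P" "x \<sharp> y \<Longrightarrow> y \<in> P"
  unfolding npar_def by auto

lemma eqv_P: "x \<simeq> y \<Longrightarrow> x \<in> P" "x \<simeq> y \<Longrightarrow> y \<in> P"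
  unfolding eqv_def by auto

lemma ex1_pt: "M \<in> C \<Longrightarrow> x \<in> P \<Longrightarrow> \<exists>!q. q \<in> M \<and> par q x"
  using ax_pt by blast

lemma pt_mem: "M \<in> C \<Longrightarrow> x \<in> P \<Longrightarrow> M \<star> x \<in> M"
  using theI'[OF ex1_pt] unfolding pt_def by blast

lemma pt_eqv: "M \<in> C \<Longrightarrow> x \<in> P \<Longrightarrow> M \<star> x \<simeq> x"
  using theI'[OF ex1_pt] circle_sub unfolding pt_def eqv_def by blast

lemma pt_unique: "M \<in> C \<Longrightarrow> y \<in> M \<Longrightarrow> y \<simeq> x \<Longrightarrow> M \<star> x = y"
  using the1_equality[OF ex1_pt] unfolding pt_def eqv_def by blast

lemma pt_id: "M \<in> C \<Longrightarrow> y \<in> M \<Longrightarrow> M \<star> y = y"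
  using pt_unique eqv_refl circle_sub by blast

lemma circle_eqv_eq: "M \<in> C \<Longrightarrow> x \<in> M \<Longrightarrow> y \<in> M \<Longrightarrow> x \<simeq> y \<Longrightarrow> x = y"
  using pt_unique pt_id by metis

lemma circle_npar: "M \<in> C \<Longrightarrow> x \<in> M \<Longrightarrow> y \<in> M \<Longrightarrow> x \<noteq> y \<Longrightarrow> x \<sharp> y"
  using circle_eqv_eq eqv_or_npar circle_sub by blast

lemma pt_cong: "M \<in> C \<Longrightarrow> x \<simeq> y \<Longrightarrow> M \<star> x = M \<star> y"
  by (metis eqv_P eqv_trans pt_eqv pt_mem pt_unique)

lemma pt_npar: "M \<in> C \<Longrightarrow> x \<sharp> y \<Longrightarrow> M \<star> x \<sharp> y"
  using npar_cong1 pt_eqv npar_P by blast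

lemma pt_npar': "M \<in> C \<Longrightarrow> x \<sharp> y \<Longrightarrow> x \<sharp> M \<star> y"
  using npar_sym pt_npar by blast

lemma pt_npar2: "M \<in> C \<Longrightarrow> N \<in> C \<Longrightarrow> x \<sharp> y \<Longrightarrow> M \<star> x \<sharp> N \<star> y"
  using pt_npar' pt_npar by blast

lemma join_ex1:
  assumes "p \<sharp> q" "q \<sharp> r" "p \<sharp> r"
  shows "\<exists>!M. M \<in> C \<and> p \<in> M \<and> q \<in> M \<and> r \<in> M"
  using assms unfolding npar_def by (intro ax_join[rule_format]) auto

lemma touch_ex1:
  assumes "M \<in> C" "a \<in> M" "a \<sharp> q" "q \<notin> M"
  shows "\<exists>!N. N \<in> C \<and> q \<in> N \<and> M \<inter> N = {a}"
  using assms unfolding npar_def by (intro ax_touch[rule_format]) auto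

lemma circle3: "p \<sharp> q \<Longrightarrow> q \<sharp> r \<Longrightarrow> p \<sharp> r \<Longrightarrow> \<exists>M\<in>C. p \<in> M \<and> q \<in> M \<and> r \<in> M"
  using ex1_implies_ex[OF join_ex1] by blast

lemma circle3_unique:
  assumes "M \<in> C" "N \<in> C" "p \<in> M" "q \<in> M" "r \<in> M" "p \<in> N" "q \<in> N" "r \<in> N"
    "p \<noteq> q" "q \<noteq> r" "p \<noteq> r"
  shows "M = N"
proof -
  have "p \<sharp> q" "q \<sharp> r" "p \<sharp> r" using assms circle_npar by metis+
  from ex1_imp_eq[OF join_ex1[OF this], of M N] show ?thesis using assms by simp
qed

lemma circle_subset_eq: "M \<in> C \<Longrightarrow> N \<in> C \<Longrightarrow> M \<subseteq> N \<Longrightarrow> M = N"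
  by (metis circle_eqv_eq circle_sub pt_eqv pt_mem subset_antisym subset_iff)

lemma tan_sym: "tangent_at M N a \<Longrightarrow> tangent_at N M a"
  unfolding tangent_at_def by blast

lemma tan_refl: "a \<in> M \<Longrightarrow> tangent_at M M a"
  unfolding tangent_at_def by blast

lemma tan_mem: "tangent_at M N a \<Longrightarrow> a \<in> M" "tangent_at M N a \<Longrightarrow> a \<in> N"
  unfolding tangent_at_def by blast+

lemma tan_int: "tangent_at M N a \<Longrightarrow> M \<noteq> N \<Longrightarrow> M \<inter> N = {a}"
  unfolding tangent_at_def by blast

lemma tan_other: "tangent_at M N a \<Longrightarrow> x \<in> M \<Longrightarrow> x \<in> N \<Longrightarrow> x \<noteq> a \<Longrightarrow> M = N"
  unfolding tangent_at_def by blast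

lemma tan_exists: assumes "M \<in> C" "a \<in> M" "a \<sharp> q"
  shows "\<exists>N\<in>C. tangent_at M N a \<and> q \<in> N"
proof (cases "q \<in> M")
  case True then show ?thesis using assms by (intro bexI[of _ M]) (auto simp: tan_refl)
next
  case False
  from ex1_implies_ex[OF touch_ex1[OF assms False]] show ?thesis
    unfolding tangent_at_def by blast
qed

lemma tan_unique:
  assumes "M \<in> C" "N \<in> C" "N' \<in> C" "tangent_at M N a" "tangent_at M N' a"
    "q \<in> N" "q \<in> N'" "a \<noteq> q"
  shows "N = N'"
proof (cases "q \<in> M")
  case True then show ?thesis using assms tan_other by metis
next
  case False
  have "a \<sharp> q" using circle_npar[OF assms(2) _ assms(6,8)] tan_mem[OF assms(4)] by metis
  moreover have "a \<in> M" using assms tan_mem by metis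
  moreover have "M \<inter> N = {a}" "M \<inter> N' = {a}" using assms False tan_int by metis+
  ultimately show ?thesis
    using ex1_imp_eq[OF touch_ex1[OF assms(1) _ _ False], of a N N'] assms by simp
qed

lemma tan_trans:
  assumes "M \<in> C" "N \<in> C" "N' \<in> C" "tangent_at M N a" "tangent_at M N' a"
  shows "tangent_at N N' a"
proof (cases "N = N'")
  case True then show ?thesis using assms tan_mem tan_refl by metis
next
  case False
  have "x = a" if "x \<in> N" "x \<in> N'" for x using tan_unique[OF assms that] False by metis
  moreover have "a \<in> N" "a \<in> N'" using assms tan_mem by metis+
  ultimately show ?thesis unfolding tangent_at_def by blast
qed

section \<open>Consequences of (C) and (S) for tangent circles\<close>

lemma C_exists:
  assumes "K \<in> C" "L \<in> C" "a \<in> K" "a \<notin> L"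
  shows "\<exists>M\<in>C. \<exists>b. tangent_at K M a \<and> tangent_at M L b"
proof -
  obtain M where M: "M \<in> pencil C a K" "card (M \<inter> L) = 1"
    using ex1_implies_ex[OF axC[unfolded axiom_C_def, rule_format, of K L a]] assms by auto
  then obtain b where "M \<inter> L = {b}" by (meson card_1_singletonE)
  then show ?thesis using M unfolding pencil_def tangent_at_def by blast
qed

lemma C_unique:
  assumes "K \<in> C" "L \<in> C" "a \<notin> L" "M \<in> C" "M' \<in> C"
    "tangent_at K M a" "tangent_at M L b" "tangent_at K M' a" "tangent_at M' L b'"
  shows "M = M'"
proof -
  have "a \<in> K - L" using assms tan_mem by fast
  then have ex: "\<exists>!M. M \<in> pencil C a K \<and> card (M \<inter> L) = 1"
    using axC[unfolded axiom_C_def, rule_format, of K L a] assms(1,2) by metis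
  have "M \<noteq> L" "M' \<noteq> L" using assms tan_mem by metis+
  then have "M \<inter> L = {b}" "M' \<inter> L = {b'}" using assms tan_int by metis+
  then have "card (M \<inter> L) = 1" "card (M' \<inter> L) = 1" by simp_all
  moreover have "M \<in> pencil C a K" "M' \<in> pencil C a K"
    using assms tan_sym unfolding pencil_def by auto
  ultimately show ?thesis using ex1_imp_eq[OF ex, of M M'] by simp
qed

text \<open>If \<open>a\<close> and \<open>b\<close> differed, \<open>a\<close> would lie off
  \<open>M\<close>. Then \<open>K\<close> and \<open>L\<close> both touch \<open>K\<close> at
  \<open>a\<close> and both touch \<open>M\<close>, so the uniqueness part of (C) identifies
  them.\<close>

lemma three_tangent:
  assumes "K \<in> C" "L \<in> C" "M \<in> C" "tangent_at K L a" "tangent_at L M b" "tangent_at M K c"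
    "K \<noteq> L" "L \<noteq> M" "M \<noteq> K"
  shows "a = b"
proof (rule ccontr)
  assume "a \<noteq> b"
  then have "a \<notin> M" using assms tan_mem tan_other by metis
  then have "K = L"
    using C_unique[of K M a K L c b] assms tan_refl tan_sym tan_mem by metis
  then show False using assms by metis
qed

lemma S_circle:
  assumes "K \<in> C" "L \<in> C" "M \<in> C" "N \<in> C"
    "tangent_at K L a" "tangent_at L M b" "tangent_at M N c" "tangent_at N K d"
    "K \<noteq> L" "L \<noteq> M" "M \<noteq> N" "N \<noteq> K" "a \<sharp> c"
  shows "\<exists>Z\<in>C. a \<in> Z \<and> b \<in> Z \<and> c \<in> Z \<and> d \<in> Z"
proof -
  have "K \<inter> L = {a} \<and> L \<inter> M = {b} \<and> M \<inter> N = {c} \<and> N \<inter> K = {d} \<and> \<not> par a c"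
    using assms(5-) tan_int unfolding npar_def by metis
  with axS[unfolded axiom_S_def, rule_format, OF assms(1-4)] show ?thesis by metis
qed

text \<open>In the model where circles are quadratic polynomials, \<open>polar g h K L\<close> says that the polar form
  of \<open>K - L\<close> vanishes at the pair of generators \<open>g\<close>, \<open>h\<close>; this makes it a symmetric
  equivalence relation.\<close>

definition polar :: "'p \<Rightarrow> 'p \<Rightarrow> 'p set \<Rightarrow> 'p set \<Rightarrow> bool" where
  "polar g h K L \<longleftrightarrow> (\<exists>W\<in>C. tangent_at W K (K \<star> g) \<and> tangent_at W L (L \<star> h))"

lemma polarI: "W \<in> C \<Longrightarrow> tangent_at W K (K \<star> g) \<Longrightarrow> tangent_at W L (L \<star> h) \<Longrightarrow> polar g h K L"
  unfolding polar_def by blast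

lemma polar_flip: "polar g h K L \<Longrightarrow> polar h g L K"
  unfolding polar_def by blast

lemma polar_refl: "K \<in> C \<Longrightarrow> g \<sharp> h \<Longrightarrow> polar g h K K"
  using polarI tan_refl pt_mem npar_P by metis

lemma polar_tan1: "K \<in> C \<Longrightarrow> L \<in> C \<Longrightarrow> g \<sharp> h \<Longrightarrow> tangent_at K L (K \<star> g) \<Longrightarrow> polar g h K L"
  using polarI[of L K g L h] tan_refl pt_mem npar_P tan_sym by metis

lemma polar_tan2: "K \<in> C \<Longrightarrow> L \<in> C \<Longrightarrow> g \<sharp> h \<Longrightarrow> tangent_at K L (L \<star> h) \<Longrightarrow> polar g h K L"
  using polarI[of K K g L h] tan_refl pt_mem npar_P by metis

text \<open>In the model \<open>K - L\<close> is a multiple of (X - a)^2, whose polar form at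
  \<open>g\<close>, \<open>h\<close> is the same multiple of (a - g)(a - h). Synthetically,
  \<open>K\<close>, \<open>L\<close> and the witness \<open>W\<close> would be three distinct
  pairwise tangent circles with contact points on different generators.\<close>

lemma polar_eq:
  assumes "K \<in> C" "L \<in> C" "g \<sharp> h" "polar g h K L" "tangent_at K L a" "a \<sharp> g" "a \<sharp> h"
  shows "K = L"
proof (rule ccontr)
  assume ne: "K \<noteq> L"
  obtain W where W: "W \<in> C" "tangent_at W K (K \<star> g)" "tangent_at W L (L \<star> h)"
    using assms unfolding polar_def by blast
  have a: "a \<noteq> K \<star> g" "a \<noteq> L \<star> h"
    using assms pt_eqv npar_P npar_ne pt_npar' by metis+
  have i: "K \<inter> L = {a}" using tan_int assms ne by metis
  have "W \<noteq> K" using W i a tan_mem by (metis IntI singletonD)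
  moreover have "W \<noteq> L" using W i a tan_mem by (metis IntI singletonD)
  ultimately show False
    using three_tangent[of K L W a "L \<star> h" "K \<star> g"] assms W ne a tan_sym by metis
qed

text \<open>The witness touches \<open>L\<close> and yet meets it in both \<open>K \<star> g\<close>
  and \<open>L \<star> h\<close>, so it is \<open>L\<close> itself.\<close>

lemma polar_same_point:
  assumes "K \<in> C" "L \<in> C" "g \<sharp> h" "polar g h K L" "K \<star> g \<in> L"
  shows "tangent_at K L (K \<star> g)"
proof -
  obtain W where W: "W \<in> C" "tangent_at W K (K \<star> g)" "tangent_at W L (L \<star> h)"
    using assms unfolding polar_def by blast
  have "K \<star> g \<noteq> L \<star> h" using pt_npar2 npar_ne assms by metis
  then have "W = L" using W assms tan_mem tan_other by metis
  then show ?thesis using W tan_sym by metis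
qed

text \<open>By (C) only one circle touches \<open>K\<close> at \<open>K \<star> g\<close> and also
  touches \<open>L\<close>; being different from \<open>L\<close>, it has one contact point there,
  which determines the second generator.\<close>

lemma polar_unique:
  assumes "K \<in> C" "L \<in> C" "g \<in> P" "h \<in> P" "h' \<in> P" "polar g h K L" "polar g h' K L" "K \<star> g \<notin> L"
  shows "h \<simeq> h'"
proof -
  obtain W where W: "W \<in> C" "tangent_at W K (K \<star> g)" "tangent_at W L (L \<star> h)"
    using assms unfolding polar_def by blast
  obtain W' where W': "W' \<in> C" "tangent_at W' K (K \<star> g)" "tangent_at W' L (L \<star> h')"
    using assms unfolding polar_def by blast
  have "W = W'" using C_unique[OF assms(1,2,8) W(1) W'(1)] W W' tan_sym by metis
  moreover have "W \<noteq> L" using W assms tan_mem by metis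
  ultimately have "L \<star> h = L \<star> h'" using W W' tan_mem tan_other by metis
  then show ?thesis using pt_eqv assms eqv_sym eqv_trans by metis
qed

text \<open>(C) supplies \<open>M\<close> touching \<open>K\<close> at \<open>K \<star> h\<close>
  and \<open>L\<close> at some \<open>b\<close>. If \<open>b\<close> were off the generator of
  \<open>g\<close>, (S) for the closed chain \<open>K\<close>, \<open>W\<close>, \<open>L\<close>,
  \<open>M\<close> would put the distinct parallel points \<open>K \<star> h\<close> and
  \<open>L \<star> h\<close> on one circle. Tangent \<open>K\<close> and \<open>L\<close> are
  treated apart because the chain may then degenerate.\<close>

lemma polar_swap:
  assumes "K \<in> C" "L \<in> C" "g \<sharp> h" "polar g h K L"
  shows "polar h g K L"
proof (cases "\<exists>z. tangent_at K L z")
  case True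
  then obtain z where z: "tangent_at K L z" by blast
  show ?thesis
  proof (cases "z \<sharp> g \<and> z \<sharp> h")
    case True
    then have "K = L" using polar_eq assms z by metis
    then show ?thesis using polar_refl assms npar_sym by metis
  next
    case False
    moreover have "z \<in> P" using z assms tan_mem circle_sub by metis
    ultimately have "z \<simeq> g \<or> z \<simeq> h" using eqv_or_npar assms npar_P by metis
    then have "K \<star> h = z \<or> L \<star> g = z" using pt_unique z assms tan_mem by metis
    then show ?thesis using z polar_tan1 polar_tan2 assms npar_sym by metis
  qed
next
  case False
  obtain W where W: "W \<in> C" "tangent_at W K (K \<star> g)" "tangent_at W L (L \<star> h)"
    using assms unfolding polar_def by blast
  have P: "g \<in> P" "h \<in> P" using assms npar_P by auto
  have ne: "W \<noteq> K" "W \<noteq> L" using W False tan_sym by metis+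
  have "K \<star> h \<notin> L"
  proof
    assume a: "K \<star> h \<in> L"
    then have "K \<star> h = L \<star> h" using pt_unique pt_eqv assms P by metis
    moreover have "L \<star> h \<noteq> K \<star> g" using pt_npar2 npar_ne assms npar_sym by metis
    ultimately have "W = K" using W tan_other tan_mem pt_mem assms P by metis
    then show False using ne by blast
  qed
  then obtain M b where M: "M \<in> C" "tangent_at K M (K \<star> h)" "tangent_at M L b"
    using C_exists assms pt_mem P by metis
  have neM: "M \<noteq> L" "M \<noteq> K" using M False tan_sym by metis+
  have bP: "b \<in> P" using M tan_mem circle_sub by metis
  have "b \<simeq> g"
  proof (rule ccontr)
    assume "\<not> b \<simeq> g"
    then have "b \<sharp> g" using eqv_or_npar bP P by metis
    then have "K \<star> g \<sharp> b" using npar_sym pt_npar assms by metis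
    then obtain Z where Z: "Z \<in> C" "L \<star> h \<in> Z" "K \<star> h \<in> Z"
      using S_circle[of K W L M "K \<star> g" "L \<star> h" b "K \<star> h"] assms W M ne neM tan_sym by metis
    then have "K \<star> h = L \<star> h"
      using circle_eqv_eq pt_eqv eqv_sym eqv_trans assms P by meson
    then show False using \<open>K \<star> h \<notin> L\<close> pt_mem assms P by metis
  qed
  then have "b = L \<star> g" using M tan_mem pt_unique assms by metis
  then show ?thesis using polarI M tan_sym by metis
qed

lemma polar_sym: "K \<in> C \<Longrightarrow> L \<in> C \<Longrightarrow> g \<sharp> h \<Longrightarrow> polar g h K L \<Longrightarrow> polar g h L K"
  using polar_swap polar_flip by metis

text \<open>\<open>W\<close> and \<open>W'\<close> touch \<open>K\<close> at the same point
  \<open>a\<close>, hence each other. A circle \<open>D\<close> touching \<open>W\<close> at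
  \<open>b\<close> and \<open>M\<close> at \<open>e\<close> closes the chain \<open>W\<close>,
  \<open>W'\<close>, \<open>M\<close>, \<open>D\<close>; (S) would join the distinct parallel points
  \<open>b\<close> and \<open>d\<close> unless \<open>e\<close> lies on the generator of
  \<open>g\<close>. Since \<open>D\<close> also touches \<open>L\<close> at \<open>b\<close>, it
  witnesses \<open>polar h g L M\<close>. The remaining cases are degenerate chains.\<close>

lemma polar_trans0:
  assumes "K \<in> C" "L \<in> C" "M \<in> C" "g \<sharp> h" "polar g h K L" "polar g h K M"
  shows "polar g h L M"
proof -
  obtain W where W: "W \<in> C" "tangent_at W K (K \<star> g)" "tangent_at W L (L \<star> h)"
    using assms unfolding polar_def by blast
  obtain W' where W': "W' \<in> C" "tangent_at W' K (K \<star> g)" "tangent_at W' M (M \<star> h)"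
    using assms unfolding polar_def by blast
  have P: "g \<in> P" "h \<in> P" using assms npar_P by auto
  define a where "a = K \<star> g"
  define b where "b = L \<star> h"
  define d where "d = M \<star> h"
  have WW': "tangent_at W W' a" using tan_trans[of K] assms W W' tan_sym unfolding a_def by metis
  have ab: "a \<sharp> b" "a \<sharp> d" unfolding a_def b_def d_def using pt_npar2 assms by metis+
  have bdeqv: "b \<simeq> d" unfolding b_def d_def using pt_eqv assms P eqv_sym eqv_trans by meson
  show ?thesis
  proof (cases "b = d")
    case True
    then have "W = W'"
      using tan_unique[of K W W' a b] assms W W' ab npar_ne tan_sym tan_mem
      unfolding a_def b_def d_def by metis
    then have "tangent_at L M b"
      using tan_trans[of W L M b] W W' True assms unfolding b_def d_def by metis
    then show ?thesis using polar_tan2 True assms unfolding d_def by metis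
  next
    case False
    have bM: "b \<notin> M"
    proof
      assume "b \<in> M"
      then have "M \<star> h = b" using pt_unique pt_eqv assms P unfolding b_def by metis
      then show False using False d_def by simp
    qed
    have WW: "W \<noteq> W'"
    proof
      assume "W = W'"
      then have "b \<in> W" "d \<in> W" using W W' tan_mem unfolding b_def d_def by metis+
      then show False using False bdeqv circle_eqv_eq W by metis
    qed
    have bW: "b \<in> W" "b \<in> L" using W tan_mem unfolding b_def by metis+
    obtain D e where D: "D \<in> C" "tangent_at W D b" "tangent_at D M e"
      using C_exists[of W M b] bM bW W assms by metis
    have DL: "tangent_at D L b" using tan_trans[of W D L b] D W assms unfolding b_def by metis
    have eP: "e \<in> P" using D tan_mem circle_sub by metis
    have aM: "tangent_at D M (M \<star> g)" if "a \<in> M" "tangent_at D M a"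
    proof -
      have "M \<star> g = a" using that pt_unique pt_eqv assms P unfolding a_def by metis
      then show ?thesis using that by simp
    qed
    have "tangent_at D M (M \<star> g)"
    proof (cases "W' = M")
      case True
      then have "tangent_at W M a" using WW' by simp
      then have "D = W" using C_unique[of W M b D W e a] bM bW D W assms tan_refl by metis
      then show ?thesis using aM True WW' tan_mem by metis
    next
      case W'M: False
      show ?thesis
      proof (cases "D = W")
        case True
        have "a \<in> M"
        proof (rule ccontr)
          assume "a \<notin> M"
          then have "W = W'"
            using C_unique[of W M a W W' e d] True D W W' WW' assms tan_refl tan_mem
            unfolding d_def by metis
          then show False using WW by metis
        qed
        moreover have "W \<noteq> M" using bW bM by blast
        ultimately have "e = a" using D True WW' tan_mem tan_other by metis
        then show ?thesis using aM D \<open>a \<in> M\<close> by metis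
      next
        case DW: False
        have DM: "D \<noteq> M" using D bM tan_mem by metis
        have "e \<simeq> g"
        proof (rule ccontr)
          assume "\<not> e \<simeq> g"
          then have "a \<sharp> e"
            using eqv_or_npar eP P npar_sym pt_npar assms unfolding a_def by metis
          then obtain Z where "Z \<in> C" "d \<in> Z" "b \<in> Z"
            using S_circle[of W W' M D a d e b] W W' D WW' assms WW W'M DM DW tan_sym
            unfolding d_def by metis
          then show False using False bdeqv circle_eqv_eq by metis
        qed
        then have "M \<star> g = e" using pt_unique D tan_mem assms by metis
        then show ?thesis using D by simp
      qed
    qed
    then have "polar h g L M" using polarI[of D L h M g] D DL unfolding b_def by metis
    then show ?thesis using polar_swap assms npar_sym by metis
  qed
qed

lemma polar_trans:
  "K \<in> C \<Longrightarrow> L \<in> C \<Longrightarrow> M \<in> C \<Longrightarrow> g \<sharp> h \<Longrightarrow> polar g h K L \<Longrightarrow> polar g h L M \<Longrightarrow> polar g h K M"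
  using polar_trans0[of L K M g h] polar_sym by metis

end

section \<open>Circles meeting a base circle in prescribed points\<close>

text \<open>In a transitive commuting family a map is determined by one value. Here
  \<open>w k\<close> is \<open>f i k\<close> followed by the inverse of \<open>f i i\<close>. By
  \<open>comp\<close>, \<open>f c d\<close> is \<open>w c\<close>, then \<open>w d\<close>, then
  \<open>f i i\<close>, and \<open>sym\<close> turns this into commutation of the
  \<open>w k\<close>. The value of \<open>f c d\<close> at \<open>w j x0\<close> therefore depends
  only on its value at \<open>x0\<close>.\<close>

lemma symmetric_family_determined:
  fixes f :: "'i \<Rightarrow> 'i \<Rightarrow> 'a \<Rightarrow> 'b" and g :: "'i \<Rightarrow> 'i \<Rightarrow> 'b \<Rightarrow> 'a"
  assumes f: "\<And>i j x. i \<in> I \<Longrightarrow> j \<in> I \<Longrightarrow> x \<in> X \<Longrightarrow> f i j x \<in> Y"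
    and g: "\<And>i j y. i \<in> I \<Longrightarrow> j \<in> I \<Longrightarrow> y \<in> Y \<Longrightarrow> g i j y \<in> X"
    and gf: "\<And>i j x. i \<in> I \<Longrightarrow> j \<in> I \<Longrightarrow> x \<in> X \<Longrightarrow> g i j (f i j x) = x"
    and fg: "\<And>i j y. i \<in> I \<Longrightarrow> j \<in> I \<Longrightarrow> y \<in> Y \<Longrightarrow> f i j (g i j y) = y"
    and sym: "\<And>i j x. f i j x = f j i x"
    and comp: "\<And>i j k x. i \<in> I \<Longrightarrow> j \<in> I \<Longrightarrow> k \<in> I \<Longrightarrow> x \<in> X \<Longrightarrow>
      f j k (g j j (f i j x)) = f i k x"
    and trans: "\<And>x x0. x \<in> X \<Longrightarrow> x0 \<in> X \<Longrightarrow> \<exists>i\<in>I. \<exists>j\<in>I. x = g i i (f i j x0)"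
    and I: "a \<in> I" "b \<in> I" "a' \<in> I" "b' \<in> I" and X: "x0 \<in> X" "x \<in> X"
    and eq: "f a b x0 = f a' b' x0"
  shows "f a b x = f a' b' x"
proof -
  \<comment> \<open>The normalising index \<open>i\<close> is chosen after \<open>x\<close> and
    \<open>x0\<close>, so that \<open>x\<close> becomes \<open>w j x0\<close>.\<close>
  obtain i j where ij: "i \<in> I" "j \<in> I" "x = g i i (f i j x0)" using trans X by metis
  define w where "w k x = g i i (f i k x)" for k x
  have w: "w k x \<in> X" if "k \<in> I" "x \<in> X" for k x
    unfolding w_def using f g ij that by metis
  have key: "f c d x = f i i (w d (w c x))" if "c \<in> I" "d \<in> I" "x \<in> X" for c d x
  proof -
    have "f c d x = f i d (w c x)"
      unfolding w_def using comp[of c i d x] sym[of c i x] ij that by metis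
    then show ?thesis unfolding w_def using fg f w ij that unfolding w_def by metis
  qed
  have gkey: "g i i (f c d x) = w d (w c x)" if "c \<in> I" "d \<in> I" "x \<in> X" for c d x
    using key gf w ij that by metis
  have comm: "w c (w d x) = w d (w c x)" if "c \<in> I" "d \<in> I" "x \<in> X" for c d x
    using gkey[of c d x] gkey[of d c x] sym[of c d x] that by metis
  have "f c d x = f i i (w j (g i i (f c d x0)))" if "c \<in> I" "d \<in> I" for c d
  proof -
    have x: "x = w j x0" using ij unfolding w_def by simp
    have "f c d x = f i i (w d (w c (w j x0)))" using key that X x by metis
    also have "w d (w c (w j x0)) = w d (w j (w c x0))" using comm that X ij by metis
    also have "\<dots> = w j (w d (w c x0))" using comm that X ij w by metis
    also have "\<dots> = w j (g i i (f c d x0))" using gkey that X by metis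
    finally show ?thesis .
  qed
  then show ?thesis using eq I by metis
qed

context laguerre_CS
begin

text \<open>The witness \<open>W\<close> of \<open>polar c d T R\<close> closes the chain
  \<open>T\<close>, \<open>W\<close>, \<open>R\<close>, \<open>V\<close>, to which (S) applies. If
  \<open>T\<close> or \<open>R\<close> is \<open>V\<close>, \<open>polar_eq\<close> makes all three
  circles coincide and \<open>V\<close> serves as \<open>Z\<close>.\<close>

lemma polar_concyclic1:
  assumes C: "V \<in> C" "T \<in> C" "R \<in> C"
    and n: "k \<sharp> l" "c \<sharp> d" "c \<sharp> k" "c \<sharp> l" "d \<sharp> k" "d \<sharp> l"
    and t: "tangent_at V T (V \<star> k)" "tangent_at V R (V \<star> l)" and B: "polar c d T R"
  shows "\<exists>Z\<in>C. V \<star> k \<in> Z \<and> V \<star> l \<in> Z \<and> T \<star> c \<in> Z \<and> R \<star> d \<in> Z"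
proof -
  have P: "k \<in> P" "l \<in> P" "c \<in> P" "d \<in> P" using n npar_P by metis+
  have vk: "V \<star> k \<in> V" "V \<star> l \<in> V" "V \<star> k \<noteq> V \<star> l"
    using pt_mem C P npar_ne pt_npar2 n by metis+
  consider "T = V" | "R = V" | "T \<noteq> V" "R \<noteq> V" by blast
  then show ?thesis
  proof cases
    case 1
    then have "V = R"
      using polar_eq[of V R c d "V \<star> l"] B C t n npar_sym pt_npar by metis
    then show ?thesis using 1 C P pt_mem by metis
  next
    case 2
    then have "T = V"
      using polar_eq[of T V c d "V \<star> k"] B C t tan_sym n npar_sym pt_npar by metis
    then show ?thesis using 2 C P pt_mem by metis
  next
    case 3
    obtain W where W: "W \<in> C" "tangent_at W T (T \<star> c)" "tangent_at W R (R \<star> d)"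
      using B unfolding polar_def by blast
    have TR: "T \<noteq> R" using 3 t tan_mem tan_other vk by metis
    have "W \<noteq> T"
    proof
      assume "W = T"
      then have "V \<star> k = R \<star> d"
        using three_tangent[of V T R "V \<star> k" "R \<star> d" "V \<star> l"] C t W TR 3 tan_sym by metis
      then show False using pt_npar2 C n npar_ne npar_sym by metis
    qed
    moreover have "W \<noteq> R"
    proof
      assume "W = R"
      then have "V \<star> k = T \<star> c"
        using three_tangent[of V T R "V \<star> k" "T \<star> c" "V \<star> l"] C t W TR 3 tan_sym by metis
      then show False using pt_npar2 C n npar_ne npar_sym by metis
    qed
    moreover have "T \<star> c \<sharp> V \<star> l" using pt_npar2 C n by metis
    ultimately show ?thesis
      using S_circle[of T W R V "T \<star> c" "R \<star> d" "V \<star> l" "V \<star> k"] C W 3 t tan_sym by metis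
  qed
qed

text \<open>By (C) some \<open>M\<close> touches \<open>T\<close> at \<open>T \<star> c\<close> and
  \<open>R\<close> at a point \<open>e\<close>. (S) puts \<open>e\<close> on the circle through
  \<open>V \<star> k\<close>, \<open>V \<star> l\<close>, \<open>T \<star> c\<close>, which is
  \<open>Z\<close>. As \<open>R\<close> meets \<open>Z\<close> only in \<open>V \<star> l\<close>
  and \<open>R \<star> d\<close>, it remains to exclude \<open>e = V \<star> l\<close>, where
  \<open>T\<close>, \<open>M\<close>, \<open>V\<close> would be pairwise tangent.\<close>

lemma polar_concyclic2:
  assumes C: "V \<in> C" "T \<in> C" "R \<in> C"
    and n: "k \<sharp> l" "c \<sharp> d" "c \<sharp> k" "c \<sharp> l" "d \<sharp> k" "d \<sharp> l"
    and t: "tangent_at V T (V \<star> k)" "tangent_at V R (V \<star> l)"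
    and Z: "Z \<in> C" "V \<star> k \<in> Z" "V \<star> l \<in> Z" "T \<star> c \<in> Z" "R \<star> d \<in> Z"
  shows "polar c d T R"
proof -
  have P: "k \<in> P" "l \<in> P" "c \<in> P" "d \<in> P" using n npar_P by metis+
  have vk: "V \<star> k \<in> V" "V \<star> l \<in> V" "V \<star> k \<noteq> V \<star> l" "T \<star> c \<in> T" "R \<star> d \<in> R"
    using pt_mem C P npar_ne pt_npar2 n by metis+
  have ne: "T \<star> c \<noteq> V \<star> k" "T \<star> c \<noteq> V \<star> l" "R \<star> d \<noteq> V \<star> k" "R \<star> d \<noteq> V \<star> l" "T \<star> c \<noteq> R \<star> d"
    using pt_npar2 C n npar_ne by metis+
  consider "T = V" | "R = V" | "T \<noteq> V" "R \<noteq> V" by blast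
  then show ?thesis
  proof cases
    case 1
    then have "Z = V" using circle3_unique[of Z V "V \<star> k" "V \<star> l" "T \<star> c"] Z C vk ne by metis
    then have "V = R" using tan_other t vk ne Z by metis
    then show ?thesis using 1 polar_refl C n by metis
  next
    case 2
    then have "Z = V" using circle3_unique[of Z V "V \<star> k" "V \<star> l" "R \<star> d"] Z C vk ne by metis
    then have "V = T" using tan_other t vk ne Z by metis
    then show ?thesis using 2 polar_refl C n by metis
  next
    case 3
    have ZR: "Z \<noteq> R" using tan_other t vk Z 3 by metis
    have tR: "V \<star> l \<in> R" "V \<star> k \<in> T" using t tan_mem by metis+
    have TcR: "T \<star> c \<notin> R"
      using circle3_unique[of Z R "V \<star> l" "R \<star> d" "T \<star> c"] Z C vk ne ZR tR by metis
    obtain M e where M: "M \<in> C" "tangent_at T M (T \<star> c)" "tangent_at M R e"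
      using C_exists[of T R "T \<star> c"] TcR C vk by metis
    have e: "e \<in> R" "e \<in> M" "T \<star> c \<in> M" using M tan_mem by metis+
    have MR: "M \<noteq> R" using TcR e by metis
    have MT: "M \<noteq> T"
    proof
      assume MT: "M = T"
      have "T \<noteq> R" using TcR vk by metis
      then have "V \<star> k = e" "e = V \<star> l"
        using three_tangent[of V T R "V \<star> k" e "V \<star> l"] three_tangent[of T R V e "V \<star> l" "V \<star> k"]
          MT M C t 3 tan_sym by metis+
      then show False using vk by simp
    qed
    have "T \<star> c \<sharp> V \<star> l" using pt_npar2 C n by metis
    then obtain Z' where Z': "Z' \<in> C" "T \<star> c \<in> Z'" "e \<in> Z'" "V \<star> l \<in> Z'" "V \<star> k \<in> Z'"
      using S_circle[of T M R V "T \<star> c" e "V \<star> l" "V \<star> k"] C M 3 MT MR t tan_sym by metis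
    have eZ: "e \<in> Z"
      using circle3_unique[of Z Z' "V \<star> k" "V \<star> l" "T \<star> c"] Z Z' vk ne by metis
    have "e \<noteq> V \<star> l"
    proof
      assume el: "e = V \<star> l"
      have MV: "M \<noteq> V" using tan_other t vk e 3 ne by metis
      have "tangent_at M V (V \<star> l)" using tan_trans[of R M V] M el t C tan_sym by metis
      then have "T \<star> c = V \<star> l"
        using three_tangent[of T M V "T \<star> c" "V \<star> l" "V \<star> k"] C M MV MT 3 t by metis
      then show False using ne by simp
    qed
    then have "e = R \<star> d"
      using circle3_unique[of Z R "V \<star> l" "R \<star> d" e] Z eZ e C vk ne ZR tR by metis
    then show ?thesis using polarI M tan_sym by metis
  qed
qed

lemma polar_concyclic:
  assumes "V \<in> C" "T \<in> C" "R \<in> C"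
    "k \<sharp> l" "c \<sharp> d" "c \<sharp> k" "c \<sharp> l" "d \<sharp> k" "d \<sharp> l"
    "tangent_at V T (V \<star> k)" "tangent_at V R (V \<star> l)"
  shows "polar c d T R \<longleftrightarrow> (\<exists>Z\<in>C. V \<star> k \<in> Z \<and> V \<star> l \<in> Z \<and> T \<star> c \<in> Z \<and> R \<star> d \<in> Z)"
  using polar_concyclic1[OF assms] polar_concyclic2[OF assms] by blast

text \<open>\<open>Z\<close> runs through the pencil of circles meeting \<open>V\<close> exactly in
  \<open>k\<close> and \<open>l\<close>; \<open>k = l\<close> is allowed and means tangency. In the
  model, for \<open>s\<close> and \<open>t\<close> on generators \<open>c\<close> and
  \<open>d\<close>, the heights of \<open>s\<close> and \<open>t\<close> above \<open>V\<close> are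
  in the ratio (c - k)(c - l) : (d - k)(d - l).\<close>

definition copencil :: "'p set \<Rightarrow> 'p \<Rightarrow> 'p \<Rightarrow> 'p \<Rightarrow> 'p \<Rightarrow> bool" where
  "copencil V k l s t \<longleftrightarrow> (\<exists>Z\<in>C. V \<inter> Z = {k, l} \<and> s \<in> Z \<and> t \<in> Z)"

lemma copencil_swap: "copencil V k l s t \<longleftrightarrow> copencil V l k s t"
  unfolding copencil_def by (simp add: insert_commute)

lemma copencil_sym: "copencil V k l s t \<Longrightarrow> copencil V k l t s"
  unfolding copencil_def by blast

lemma int_pair:
  assumes "V \<in> C" "Z \<in> C" "V \<noteq> Z" "k \<in> V" "k \<in> Z"
  shows "\<exists>l. V \<inter> Z = {k, l}"
proof (cases "V \<inter> Z = {k}")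
  case True then show ?thesis by auto
next
  case False
  then obtain l where l: "l \<in> V" "l \<in> Z" "l \<noteq> k" using assms by blast
  have "x = k \<or> x = l" if "x \<in> V" "x \<in> Z" for x
    using circle3_unique[of V Z k l x] assms l that by metis
  then have "V \<inter> Z = {k, l}" using l assms by blast
  then show ?thesis by blast
qed

lemma int_two:
  assumes "V \<in> C" "Z \<in> C" "k \<in> V" "l \<in> V" "k \<in> Z" "l \<in> Z" "k \<noteq> l" "s \<in> Z" "s \<notin> V"
  shows "V \<inter> Z = {k, l}"
proof -
  obtain m where m: "V \<inter> Z = {k, m}" using int_pair[of V Z k] assms by metis
  have "l \<in> V \<inter> Z" using assms by simp
  then have "l = m" using m \<open>k \<noteq> l\<close> by auto
  then show ?thesis using m by simp
qed

lemma copencil_circle_ex: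
  assumes "V \<in> C" "k \<in> V" "l \<in> V" "s \<notin> V" "s \<sharp> k" "s \<sharp> l"
  shows "\<exists>Z\<in>C. V \<inter> Z = {k, l} \<and> s \<in> Z"
proof (cases "k = l")
  case True
  obtain Z where "Z \<in> C" "tangent_at V Z k" "s \<in> Z"
    using tan_exists[of V k s] assms npar_sym by metis
  then show ?thesis using True assms tan_int[of V Z k] by (intro bexI[of _ Z]) auto
next
  case False
  obtain Z where Z: "Z \<in> C" "s \<in> Z" "k \<in> Z" "l \<in> Z"
    using circle3[of s k l] circle_npar[of V k l] assms False by metis
  then have "V \<inter> Z = {k, l}" using int_two assms False by metis
  then show ?thesis using Z by blast
qed

lemma copencil_circle_unique:
  assumes "V \<in> C" "Z \<in> C" "Z' \<in> C" "V \<inter> Z = {k, l}" "V \<inter> Z' = {k, l}" "s \<in> Z" "s \<in> Z'" "s \<notin> V"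
  shows "Z = Z'"
proof (cases "k = l")
  case True
  then have "tangent_at V Z k" "tangent_at V Z' k" "s \<noteq> k"
    using assms unfolding tangent_at_def by auto
  then show ?thesis using tan_unique assms by metis
next
  case False
  moreover have "k \<in> V" "l \<in> V" "k \<in> Z" "l \<in> Z" "k \<in> Z'" "l \<in> Z'" using assms(4,5) by blast+
  ultimately show ?thesis using circle3_unique[of Z Z' k l s] assms by metis
qed

lemma copencil_concyclic:
  assumes "V \<in> C" "k \<in> V" "l \<in> V" "k \<noteq> l" "s \<notin> V"
  shows "copencil V k l s t \<longleftrightarrow> (\<exists>Z\<in>C. k \<in> Z \<and> l \<in> Z \<and> s \<in> Z \<and> t \<in> Z)"
proof
  assume "copencil V k l s t"
  then show "\<exists>Z\<in>C. k \<in> Z \<and> l \<in> Z \<and> s \<in> Z \<and> t \<in> Z" unfolding copencil_def by blast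
next
  assume "\<exists>Z\<in>C. k \<in> Z \<and> l \<in> Z \<and> s \<in> Z \<and> t \<in> Z"
  then show "copencil V k l s t" unfolding copencil_def using int_two assms by metis
qed

lemma copencil_not_mem:
  assumes "V \<in> C" "copencil V k l s t" "t \<sharp> k" "t \<sharp> l"
  shows "t \<notin> V"
  using assms npar_ne unfolding copencil_def by blast

lemma copencil_eq:
  assumes "V \<in> C" "copencil V k l s t" "copencil V k l s t'" "s \<notin> V" "t \<simeq> t'"
  shows "t = t'"
  using assms copencil_circle_unique circle_eqv_eq unfolding copencil_def by metis

lemma copencil_tangent:
  assumes "V \<in> C" "copencil V k k s t"
  shows "\<exists>T\<in>C. tangent_at V T k \<and> s \<in> T \<and> t \<in> T"
  using assms unfolding copencil_def tangent_at_def by auto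

text \<open>Writing \<open>u k l\<close> for the map from one generator to another given by \<open>copencil V k l\<close>, this
  says \<open>u l m \<circ> inv (u l l) \<circ> u k l = u k m\<close>; it is transitivity of \<open>polar c d\<close>.\<close>

lemma copencil_comp:
  assumes V: "V \<in> C" and m: "k \<in> V" "l \<in> V" "m \<in> V"
    and n: "c \<sharp> d" "c \<sharp> k" "c \<sharp> l" "c \<sharp> m" "d \<sharp> k" "d \<sharp> l" "d \<sharp> m"
    and e: "s \<simeq> c" "t \<simeq> d" "t' \<simeq> c" "u \<simeq> d" and s: "s \<notin> V"
    and co: "copencil V k l s t" "copencil V l l t t'" "copencil V l m t' u"
  shows "copencil V k m s u"
proof -
  have tt': "s \<sharp> k" "s \<sharp> l" "t \<sharp> k" "t \<sharp> l" "t' \<sharp> l" "t' \<sharp> m" "u \<sharp> m" "u \<sharp> l"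
    using n e npar_cong1 by metis+
  have tV: "t \<notin> V" using copencil_not_mem V co tt' by metis
  have t'V: "t' \<notin> V" using copencil_not_mem V co tt' by metis
  have uV: "u \<notin> V" using copencil_not_mem V co tt' by metis
  consider "k = l" | "l = m" | "k \<noteq> l" "l \<noteq> m" by blast
  then show ?thesis
  proof cases
    case 1
    then have "s = t'" using copencil_eq[of V l l t s t'] co copencil_sym V tV e eqv_sym eqv_trans by metis
    then show ?thesis using co 1 by simp
  next
    case 2
    then have "t = u" using copencil_eq[of V l l t' t u] co copencil_sym V t'V e eqv_sym eqv_trans by metis
    then show ?thesis using co 2 by simp
  next
    case 3
    have idk: "V \<star> k = k" "V \<star> l = l" "V \<star> m = m" using pt_id V m by metis+
    \<comment> \<open>One circle touching \<open>V\<close> is taken at each of \<open>k\<close>,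
      \<open>l\<close>, \<open>m\<close>. The middle one, \<open>R\<close>, carries both
      \<open>t\<close> and \<open>t'\<close> because the middle step is a tangent pencil; the outer
      two steps become \<open>polar c d T R\<close> and \<open>polar c d R S\<close>.\<close>
    obtain T where T: "T \<in> C" "tangent_at V T k" "s \<in> T"
      using tan_exists[of V k s] V m tt' npar_sym by metis
    obtain R where R: "R \<in> C" "tangent_at V R l" "t \<in> R" "t' \<in> R"
      using copencil_tangent co V by metis
    obtain S where S: "S \<in> C" "tangent_at V S m" "u \<in> S"
      using tan_exists[of V m u] V m tt' npar_sym by metis
    have pts: "T \<star> c = s" "R \<star> d = t" "R \<star> c = t'" "S \<star> d = u"
      using pt_unique T R S e by metis+
    have kl: "k \<sharp> l" "l \<sharp> m" using 3 circle_npar V m by metis+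
    have "polar c d T R"
      using polar_concyclic[of V T R k l c d] V T R kl n idk pts co 3 m s copencil_concyclic by simp
    moreover have "polar c d R S"
      using polar_concyclic[of V R S l m c d] V S R kl n idk pts co 3 m t'V copencil_concyclic by simp
    ultimately have BTS: "polar c d T S" using polar_trans[of T R S] T R S n by metis
    show ?thesis
    proof (cases "k = m")
      case True
      have ts: "tangent_at T S k" using tan_trans[of V T S k] T S V True by metis
      have "k \<sharp> c" "k \<sharp> d" using n npar_sym by metis+
      then have "T = S" using polar_eq[OF T(1) S(1) n(1) BTS ts] by blast
      moreover have "T \<noteq> V" using T s by metis
      ultimately have "V \<inter> T = {k, m}" using tan_int[of V T k] T True by auto
      then show ?thesis using \<open>T = S\<close> T S unfolding copencil_def by metis
    next
      case False
      then have km: "k \<sharp> m" using circle_npar V m by metis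
      then show ?thesis
        using polar_concyclic[of V T S k m c d] V T S n idk pts m s False copencil_concyclic BTS by simp
    qed
  qed
qed

text \<open>Only the target generator \<open>d\<close> is a parameter, the source being the
  generator of \<open>s\<close>. So one definition yields the maps in both directions that
  \<open>symmetric_family_determined\<close> takes as \<open>f\<close> and \<open>g\<close>.\<close>

definition transport :: "'p set \<Rightarrow> 'p \<Rightarrow> 'p \<Rightarrow> 'p \<Rightarrow> 'p \<Rightarrow> 'p" where
  "transport V d k l s = (THE t. t \<simeq> d \<and> copencil V k l s t)"

lemma transport_unique:
  assumes "V \<in> C" "s \<notin> V" "t \<simeq> d" "copencil V k l s t"
  shows "transport V d k l s = t"
  unfolding transport_def
proof (rule the_equality)
  show "t' = t" if "t' \<simeq> d \<and> copencil V k l s t'" for t'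
    using copencil_eq[of V k l s t' t] assms that eqv_sym eqv_trans by metis
qed (use assms in simp)

lemma transport_props:
  assumes "V \<in> C" "k \<in> V" "l \<in> V" "s \<notin> V" "s \<sharp> k" "s \<sharp> l" "d \<in> P"
  shows "transport V d k l s \<simeq> d" "copencil V k l s (transport V d k l s)"
proof -
  obtain Z where Z: "Z \<in> C" "V \<inter> Z = {k, l}" "s \<in> Z" using copencil_circle_ex assms by metis
  then have "Z \<star> d \<simeq> d" "copencil V k l s (Z \<star> d)"
    using pt_eqv pt_mem assms unfolding copencil_def by metis+
  then show "transport V d k l s \<simeq> d" "copencil V k l s (transport V d k l s)" using transport_unique assms by metis+
qed

text \<open>The agreement principle over a base circle, an instance of
  \<open>symmetric_family_determined\<close> with \<open>copencil_comp\<close> as composition law.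
  The indices are the points of \<open>V\<close> off both generators. The points of \<open>V\<close>
  are removed from the generators of \<open>p\<close> and \<open>q\<close>: they correspond to
  height zero, where multiplication is not transitive.\<close>

lemma copencil_determined:
  assumes V: "V \<in> C" and m: "a \<in> V" "b \<in> V" "a' \<in> V" "b' \<in> V"
    and n: "p \<sharp> q" "a \<sharp> p" "b \<sharp> p" "a' \<sharp> p" "b' \<sharp> p" "a \<sharp> q" "b \<sharp> q" "a' \<sharp> q" "b' \<sharp> q"
    and e: "s0 \<simeq> p" "s \<simeq> p" "t0 \<simeq> q" "t \<simeq> q" and s: "s0 \<notin> V" "s \<notin> V"
    and co: "copencil V a b s0 t0" "copencil V a' b' s0 t0" "copencil V a b s t"
  shows "copencil V a' b' s t"
proof -
  define I where "I = {k \<in> V. k \<sharp> p \<and> k \<sharp> q}"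
  define X where "X = {s. s \<simeq> p \<and> s \<notin> V}"
  define Y where "Y = {s. s \<simeq> q \<and> s \<notin> V}"
  have P: "p \<in> P" "q \<in> P" using n npar_P by metis+
  have Ik: "k \<in> V" "p \<sharp> k" "q \<sharp> k" if "k \<in> I" for k using that npar_sym unfolding I_def by blast+
  have Xs: "x \<simeq> p" "x \<notin> V" if "x \<in> X" for x using that unfolding X_def by blast+
  have Ys: "x \<simeq> q" "x \<notin> V" if "x \<in> Y" for x using that unfolding Y_def by blast+
  have Xn: "x \<sharp> k" if "x \<in> X" "k \<in> I" for x k using npar_cong1 Xs Ik that by metis
  have Yn: "x \<sharp> k" if "x \<in> Y" "k \<in> I" for x k using npar_cong1 Ys Ik that by metis
  have fp: "transport V q i j x \<simeq> q" "copencil V i j x (transport V q i j x)" "transport V q i j x \<in> Y"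
    if "i \<in> I" "j \<in> I" "x \<in> X" for i j x
  proof -
    show 1: "transport V q i j x \<simeq> q" "copencil V i j x (transport V q i j x)"
      using transport_props[of V i j x q] V Ik Xs Xn that P by metis+
    then have "transport V q i j x \<notin> V" using copencil_not_mem V Ik that npar_cong1 by metis
    then show "transport V q i j x \<in> Y" using 1 unfolding Y_def by blast
  qed
  have gp: "transport V p i j x \<simeq> p" "copencil V i j x (transport V p i j x)" "transport V p i j x \<in> X"
    if "i \<in> I" "j \<in> I" "x \<in> Y" for i j x
  proof -
    show 1: "transport V p i j x \<simeq> p" "copencil V i j x (transport V p i j x)"
      using transport_props[of V i j x p] V Ik Ys Yn that P by metis+
    then have "transport V p i j x \<notin> V" using copencil_not_mem V Ik that npar_cong1 by metis
    then show "transport V p i j x \<in> X" using 1 unfolding X_def by blast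
  qed
  have IN: "a \<in> I" "b \<in> I" "a' \<in> I" "b' \<in> I" using m n unfolding I_def by blast+
  have XN: "s0 \<in> X" "s \<in> X" using e s unfolding X_def by blast+
  have "transport V q a b s = transport V q a' b' s"
  proof (rule symmetric_family_determined[where f = "transport V q" and g = "transport V p" and I = I and X = X
        and Y = Y and a = a and b = b and a' = a' and b' = b' and ?x0.0 = s0 and x = s])
    show "transport V p i j (transport V q i j x) = x" if "i \<in> I" "j \<in> I" "x \<in> X" for i j x
      using transport_unique copencil_sym fp that V Xs Ys by metis
    show "transport V q i j (transport V p i j x) = x" if "i \<in> I" "j \<in> I" "x \<in> Y" for i j x
      using transport_unique copencil_sym gp that V Xs Ys by metis
    show "transport V q i j x = transport V q j i x" for i j x
      unfolding transport_def using copencil_swap by simp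
    show "transport V q j k (transport V p j j (transport V q i j x)) = transport V q i k x"
      if "i \<in> I" "j \<in> I" "k \<in> I" "x \<in> X" for i j k x
    proof -
      let ?t = "transport V q i j x" let ?t' = "transport V p j j ?t" let ?u = "transport V q j k ?t'"
      have 1: "?t \<in> Y" "?t \<simeq> q" "copencil V i j x ?t" using fp that by metis+
      have 2: "?t' \<in> X" "?t' \<simeq> p" "copencil V j j ?t ?t'" using gp that 1 by metis+
      have 3: "?u \<simeq> q" "copencil V j k ?t' ?u" using fp that 2 by metis+
      have "copencil V i k x ?u"
        using copencil_comp[of V i j k p q x ?t ?t' ?u] V Ik that n(1) Xs 1 2 3 by metis
      then show ?thesis using transport_unique V Xs that 3 by metis
    qed
    \<comment> \<open>The tangent pencil at \<open>a\<close> sends \<open>x\<close> to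
      \<open>?r\<close>. The circle through \<open>x0\<close>, \<open>?r\<close> and
      \<open>a\<close> meets \<open>V\<close> in \<open>a\<close> and a further, possibly equal,
      point \<open>j\<close>; so the map of \<open>a\<close>, \<open>j\<close> sends
      \<open>x0\<close> to the same \<open>?r\<close>.\<close>
    show "\<exists>i\<in>I. \<exists>j\<in>I. x = transport V p i i (transport V q i j x0)" if x: "x \<in> X" "x0 \<in> X" for x x0
    proof -
      let ?r = "transport V q a a x"
      have r: "?r \<in> Y" "?r \<simeq> q" "copencil V a a x ?r" using fp IN x by metis+
      have "x0 \<sharp> ?r" using npar_cong n(1) Xs x Ys r eqv_sym by metis
      moreover have "x0 \<sharp> a" "?r \<sharp> a" using Xn Yn x IN r by metis+
      ultimately obtain Z where Z: "Z \<in> C" "x0 \<in> Z" "?r \<in> Z" "a \<in> Z"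
        using circle3[of x0 ?r a] by metis
      obtain j where j: "V \<inter> Z = {a, j}" using int_pair[of V Z a] V Z Ik IN Xs x by metis
      have jm: "j \<in> V" "j \<in> Z" using j by blast+
      have "j \<noteq> x0" "j \<noteq> ?r" using jm Xs x Ys r by metis+
      then have "j \<sharp> x0" "j \<sharp> ?r" using circle_npar Z jm by metis+
      then have "j \<sharp> p" "j \<sharp> q" using npar_cong2 Xs x r eqv_sym by metis+
      then have jI: "j \<in> I" using jm unfolding I_def by blast
      have "copencil V a j x0 ?r" unfolding copencil_def using Z j by metis
      then have "transport V q a j x0 = ?r" using transport_unique V Xs x r by metis
      moreover have "transport V p a a ?r = x" using transport_unique copencil_sym V Xs x r Ys by metis
      ultimately show ?thesis using IN jI by metis
    qed
    show "transport V q a b s0 = transport V q a' b' s0" using transport_unique co V e s by metis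
  qed (use fp gp IN XN in auto)
  moreover have "transport V q a b s = t" using transport_unique V co e s by metis
  ultimately show ?thesis using fp IN XN by metis
qed

section \<open>Change of the base circle\<close>

text \<open>\<open>T\<close> and \<open>K\<close> touch on \<open>l\<close>, \<open>K\<close> and
  \<open>V\<close> on \<open>p\<close>, so transitivity gives \<open>polar p l T V\<close>. Its
  witness touches \<open>T\<close> at \<open>s\<close> and \<open>V\<close> on \<open>l\<close>,
  hence is \<open>T'\<close>.\<close>

lemma tangent_transfer:
  assumes C: "K \<in> C" "V \<in> C" "T \<in> C" "T' \<in> C" and n: "p \<sharp> l"
    and t: "tangent_at K V (K \<star> p)" "tangent_at K T (K \<star> l)" "tangent_at V T' (V \<star> l)"
    and s: "s \<simeq> p" "s \<in> T" "s \<in> T'"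
  shows "tangent_at T T' s"
proof -
  have "polar p l T K" using polar_tan2 C n t tan_sym by metis
  moreover have "polar p l K V" using polar_tan1 C n t by metis
  ultimately have "polar p l T V" using polar_trans C n by metis
  then obtain W where W: "W \<in> C" "tangent_at W T (T \<star> p)" "tangent_at W V (V \<star> l)"
    unfolding polar_def by blast
  have Ts: "T \<star> p = s" using pt_unique C s by metis
  then have sW: "s \<in> W" using W tan_mem by metis
  have "s \<sharp> V \<star> l" using npar_cong1 s n pt_npar' C by metis
  then have "V \<star> l \<noteq> s" using npar_ne by metis
  then have "W = T'" using tan_unique[of V W T' "V \<star> l" s] C W t tan_sym sW s by metis
  then show ?thesis using W Ts tan_sym by metis
qed

text \<open>\<open>K \<star> l\<close> and \<open>L \<star> l'\<close> are the points of
  \<open>W\<close> on \<open>l\<close> and \<open>l'\<close>, so the base circle \<open>W\<close>,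
  tied to \<open>l\<close> and \<open>l'\<close>, is exchanged for \<open>V\<close>, tied to
  \<open>p\<close> and \<open>q\<close>. By \<open>tangent_transfer\<close> the circles through
  \<open>s\<close> touching the two bases on \<open>l\<close> touch each other, and likewise for
  \<open>s'\<close> and \<open>l'\<close>. Hence \<open>polar p q\<close> holds for both pairs or
  for neither, and \<open>polar_concyclic\<close> translates this.\<close>

lemma concyclic_transfer:
  assumes C: "V \<in> C" "W \<in> C" "K \<in> C" "L \<in> C"
    and n: "p \<sharp> q" "l \<sharp> l'" "l \<sharp> p" "l \<sharp> q" "l' \<sharp> p" "l' \<sharp> q"
    and t: "tangent_at V K (K \<star> p)" "tangent_at V L (L \<star> q)"
      "tangent_at W K (K \<star> l)" "tangent_at W L (L \<star> l')"
    and s: "s \<simeq> p" "s' \<simeq> q"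
  shows "(\<exists>Z\<in>C. K \<star> l \<in> Z \<and> L \<star> l' \<in> Z \<and> s \<in> Z \<and> s' \<in> Z) \<longleftrightarrow>
    (\<exists>Z\<in>C. V \<star> l \<in> Z \<and> V \<star> l' \<in> Z \<and> s \<in> Z \<and> s' \<in> Z)"
proof -
  have P: "p \<in> P" "q \<in> P" "l \<in> P" "l' \<in> P" using n npar_P by metis+
  have sn: "K \<star> l \<sharp> s" "L \<star> l' \<sharp> s'" "V \<star> l \<sharp> s" "V \<star> l' \<sharp> s'"
    using pt_npar C npar_cong2 n s by metis+
  obtain T where T: "T \<in> C" "tangent_at K T (K \<star> l)" "s \<in> T"
    using tan_exists[of K "K \<star> l" s] C P pt_mem sn by metis
  obtain T' where T': "T' \<in> C" "tangent_at L T' (L \<star> l')" "s' \<in> T'"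
    using tan_exists[of L "L \<star> l'" s'] C P pt_mem sn by metis
  obtain S where S: "S \<in> C" "tangent_at V S (V \<star> l)" "s \<in> S"
    using tan_exists[of V "V \<star> l" s] C P pt_mem sn by metis
  obtain S' where S': "S' \<in> C" "tangent_at V S' (V \<star> l')" "s' \<in> S'"
    using tan_exists[of V "V \<star> l'" s'] C P pt_mem sn by metis
  have pts: "T \<star> p = s" "T' \<star> q = s'" "S \<star> p = s" "S' \<star> q = s'"
    using pt_unique T T' S S' s by metis+
  have TS: "tangent_at T S s"
    using tangent_transfer[of K V T S p l s] C T S n t s npar_sym tan_sym by metis
  have TS': "tangent_at T' S' s'"
    using tangent_transfer[of L V T' S' q l' s'] C T' S' n t s npar_sym tan_sym by metis
  have "polar p q T S" using polar_tan1[of T S p q] T S n TS pts by metis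
  moreover have "polar p q T' S'" using polar_tan2[of T' S' p q] T' S' n TS' pts by metis
  ultimately have BB: "polar p q T T' \<longleftrightarrow> polar p q S S'"
    using polar_trans polar_sym T T' S S' n by metis
  have W: "W \<star> l = K \<star> l" "W \<star> l' = L \<star> l'"
    using pt_unique[of W "K \<star> l" l] pt_unique[of W "L \<star> l'" l'] C t tan_mem pt_eqv P by metis+
  have "tangent_at W T (K \<star> l)" "tangent_at W T' (L \<star> l')"
    using tan_trans C T T' t tan_sym by metis+
  then have "polar p q T T' \<longleftrightarrow> (\<exists>Z\<in>C. K \<star> l \<in> Z \<and> L \<star> l' \<in> Z \<and> s \<in> Z \<and> s' \<in> Z)"
    using polar_concyclic[of W T T' l l' p q] C T T' n npar_sym W pts by metis
  moreover have "polar p q S S' \<longleftrightarrow> (\<exists>Z\<in>C. V \<star> l \<in> Z \<and> V \<star> l' \<in> Z \<and> s \<in> Z \<and> s' \<in> Z)"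
    using polar_concyclic[of V S S' l l' p q] C S S' n npar_sym pts by metis
  ultimately show ?thesis using BB by blast
qed

text \<open>\<open>Z1\<close> makes \<open>polar p q T T'\<close> true, and its witness
  \<open>Y\<close> passes through \<open>t\<close> and \<open>t'\<close>. Two applications of
  \<open>concyclic_transfer\<close> move the base circle from \<open>V\<close> to \<open>W\<close>
  and, with \<open>T\<close>, \<open>T'\<close> in place of \<open>K\<close>, \<open>L\<close>, from
  \<open>W\<close> to \<open>Y\<close>. The result relates two point pairs without reference to
  \<open>K\<close> and \<open>L\<close>.\<close>

lemma concyclic_exchange:
  assumes C: "V \<in> C" "W \<in> C" "K \<in> C" "L \<in> C"
    and n: "p \<sharp> q" "l \<sharp> l'" "l \<sharp> p" "l \<sharp> q" "l' \<sharp> p" "l' \<sharp> q"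
    and t: "tangent_at V K (K \<star> p)" "tangent_at V L (L \<star> q)"
      "tangent_at W K (K \<star> l)" "tangent_at W L (L \<star> l')"
    and e: "t \<simeq> p" "t' \<simeq> q" "s \<simeq> l" "s' \<simeq> l'"
    and Z1: "Z1 \<in> C" "K \<star> l \<in> Z1" "L \<star> l' \<in> Z1" "t \<in> Z1" "t' \<in> Z1"
    and Z2: "Z2 \<in> C" "K \<star> p \<in> Z2" "L \<star> q \<in> Z2" "s \<in> Z2" "s' \<in> Z2"
  shows "\<exists>Z\<in>C. t \<in> Z \<and> t' \<in> Z \<and> s \<in> Z \<and> s' \<in> Z"
proof -
  have P: "p \<in> P" "q \<in> P" "l \<in> P" "l' \<in> P" using n npar_P by metis+
  have tn: "K \<star> l \<sharp> t" "L \<star> l' \<sharp> t'" using pt_npar C npar_cong2 n e by metis+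
  obtain T where T: "T \<in> C" "tangent_at K T (K \<star> l)" "t \<in> T"
    using tan_exists[of K "K \<star> l" t] C P pt_mem tn by metis
  obtain T' where T': "T' \<in> C" "tangent_at L T' (L \<star> l')" "t' \<in> T'"
    using tan_exists[of L "L \<star> l'" t'] C P pt_mem tn by metis
  have Tpts: "T \<star> p = t" "T' \<star> q = t'" using pt_unique T T' e by metis+
  have Tl: "T \<star> l = K \<star> l" "T' \<star> l' = L \<star> l'"
    using pt_unique[of T "K \<star> l" l] pt_unique[of T' "L \<star> l'" l'] C T T' tan_mem pt_eqv P by metis+
  have W: "W \<star> l = K \<star> l" "W \<star> l' = L \<star> l'"
    using pt_unique[of W "K \<star> l" l] pt_unique[of W "L \<star> l'" l'] C t tan_mem pt_eqv P by metis+
  have WT: "tangent_at W T (K \<star> l)" "tangent_at W T' (L \<star> l')"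
    using tan_trans C T T' t tan_sym by metis+
  have "polar p q T T'"
    using polar_concyclic2[of W T T' l l' p q Z1] C T T' n npar_sym W WT Tpts Z1 by metis
  then obtain Y where Y: "Y \<in> C" "tangent_at Y T (T \<star> p)" "tangent_at Y T' (T' \<star> q)"
    unfolding polar_def by blast
  have ns: "p \<sharp> l" "p \<sharp> l'" "q \<sharp> l" "q \<sharp> l'" using n npar_sym by metis+
  have "\<exists>Z\<in>C. W \<star> p \<in> Z \<and> W \<star> q \<in> Z \<and> s \<in> Z \<and> s' \<in> Z"
    using concyclic_transfer[of W V K L l l' p q s s'] C n ns t e Z2 by metis
  then have "\<exists>Z\<in>C. T \<star> p \<in> Z \<and> T' \<star> q \<in> Z \<and> s \<in> Z \<and> s' \<in> Z"
    using concyclic_transfer[of W Y T T' l l' p q s s'] C T T' Y n ns e WT Tl by metis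
  then show ?thesis using Tpts by metis
qed

section \<open>Pairs of circles touching a common circle\<close>

lemma not_tangent_of_common:
  assumes "V \<in> C" "K \<in> C" "L \<in> C" "tangent_at V K a" "tangent_at V L b" "a \<noteq> b"
    "K \<noteq> V" "L \<noteq> V"
  shows "\<not> tangent_at K L z"
proof
  assume z: "tangent_at K L z"
  have "b \<in> V" "b \<in> L" using assms tan_mem by metis+
  then have "K \<noteq> L" using assms tan_other by metis
  then have "a = z" "z = b"
    using three_tangent[of V K L a z b] three_tangent[of K L V z b a] assms z tan_sym by metis+
  then show False using assms by simp
qed

lemma cross_concyclic:
  assumes "K \<in> C" "L \<in> C" "W \<in> C" "G \<in> C" "\<And>z. \<not> tangent_at K L z"
    "tangent_at W K (K \<star> l)" "tangent_at W L (L \<star> l')"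
    "tangent_at G K (K \<star> q)" "tangent_at G L (L \<star> p)" "l \<sharp> p"
  shows "\<exists>Z\<in>C. K \<star> l \<in> Z \<and> L \<star> l' \<in> Z \<and> L \<star> p \<in> Z \<and> K \<star> q \<in> Z"
proof -
  have "W \<noteq> K" "W \<noteq> L" "G \<noteq> K" "G \<noteq> L" using assms tan_sym by metis+
  moreover have "K \<star> l \<sharp> L \<star> p" using pt_npar2 assms by metis
  ultimately show ?thesis
    using S_circle[of K W L G "K \<star> l" "L \<star> l'" "L \<star> p" "K \<star> q"] assms tan_sym by metis
qed

lemma touching_pair:
  assumes C: "V \<in> C" "K \<in> C" "L \<in> C" and n: "p \<sharp> q"
    and t: "tangent_at V K (V \<star> p)" "tangent_at V L (V \<star> q)" and ne: "K \<noteq> V" "L \<noteq> V"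
  shows "\<not> tangent_at K L z" "K \<star> p = V \<star> p" "L \<star> q = V \<star> q" "polar p q K L" "polar q p K L"
    "L \<star> p \<notin> V" "K \<star> q \<notin> V"
proof -
  have P: "p \<in> P" "q \<in> P" using n npar_P by metis+
  have pq: "V \<star> p \<noteq> V \<star> q" using npar_ne pt_npar2 C n by metis
  show "\<not> tangent_at K L z" using not_tangent_of_common[OF C t pq ne] .
  show e: "K \<star> p = V \<star> p" "L \<star> q = V \<star> q"
    using pt_unique[of K "V \<star> p" p] pt_unique[of L "V \<star> q" q] C t tan_mem pt_eqv P by metis+
  show "polar p q K L" using polarI[of V K p L q] C t e by metis
  then show "polar q p K L" using polar_swap C n by metis
  have "V \<star> q \<noteq> L \<star> p" "V \<star> p \<noteq> K \<star> q" using npar_ne pt_npar2 C n by metis+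
  then show "L \<star> p \<notin> V" "K \<star> q \<notin> V" using tan_other[of V L] tan_other[of V K] t ne pt_mem C P by metis+
qed

text \<open>By symmetry of \<open>polar\<close> some \<open>G\<close> touches \<open>K\<close> on
  \<open>q\<close> and \<open>L\<close> on \<open>p\<close>. (S) for the chain \<open>K\<close>,
  \<open>W\<close>, \<open>L\<close>, \<open>G\<close> gives a circle through
  \<open>K \<star> l\<close> and \<open>L \<star> l'\<close>, and \<open>concyclic_transfer\<close>
  replaces these by points of \<open>V\<close>. Thus the pencil map of every such pair
  \<open>l\<close>, \<open>l'\<close> sends \<open>L \<star> p\<close> to
  \<open>K \<star> q\<close>.\<close>

lemma polar_cross1:
  assumes C: "V \<in> C" "K \<in> C" "L \<in> C" and n: "p \<sharp> q" "l \<sharp> l'" "l \<sharp> p" "l \<sharp> q" "l' \<sharp> p" "l' \<sharp> q"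
    and t: "tangent_at V K (V \<star> p)" "tangent_at V L (V \<star> q)" and ne: "K \<noteq> V" "L \<noteq> V"
    and B: "polar l l' K L"
  shows "\<exists>Z\<in>C. V \<star> l \<in> Z \<and> V \<star> l' \<in> Z \<and> L \<star> p \<in> Z \<and> K \<star> q \<in> Z"
proof -
  note tp = touching_pair[OF C n(1) t ne]
  obtain W where W: "W \<in> C" "tangent_at W K (K \<star> l)" "tangent_at W L (L \<star> l')"
    using B unfolding polar_def by blast
  obtain G where G: "G \<in> C" "tangent_at G K (K \<star> q)" "tangent_at G L (L \<star> p)"
    using tp(5) unfolding polar_def by blast
  have "\<exists>Z\<in>C. K \<star> l \<in> Z \<and> L \<star> l' \<in> Z \<and> L \<star> p \<in> Z \<and> K \<star> q \<in> Z"
    using cross_concyclic[OF C(2,3) W(1) G(1) tp(1) W(2,3) G(2,3) n(3)] .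
  moreover have "L \<star> p \<simeq> p" "K \<star> q \<simeq> q" using pt_eqv C n npar_P by metis+
  ultimately show ?thesis
    using concyclic_transfer[of V W K L p q l l' "L \<star> p" "K \<star> q"] C W n t tp(2,3) by metis
qed

text \<open>The converse is obtained by constructing the right circle: \<open>D\<close> touches
  \<open>V\<close> on \<open>q\<close> and passes through \<open>Y \<star> l'\<close>, which ensures
  \<open>polar l l' K D\<close>. By \<open>polar_cross1\<close>, \<open>D\<close> meets
  \<open>p\<close> in the same point of \<open>Z\<close> as \<open>L\<close> does, so
  \<open>D = L\<close>.\<close>

lemma polar_cross2:
  assumes C: "V \<in> C" "K \<in> C" "L \<in> C" and n: "p \<sharp> q" "l \<sharp> l'" "l \<sharp> p" "l \<sharp> q" "l' \<sharp> p" "l' \<sharp> q"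
    and t: "tangent_at V K (V \<star> p)" "tangent_at V L (V \<star> q)" and ne: "K \<noteq> V" "L \<noteq> V"
    and Z: "Z \<in> C" "V \<star> l \<in> Z" "V \<star> l' \<in> Z" "L \<star> p \<in> Z" "K \<star> q \<in> Z"
  shows "polar l l' K L"
proof -
  have P: "p \<in> P" "q \<in> P" "l \<in> P" "l' \<in> P" using n npar_P by metis+
  have "V \<star> p \<sharp> V \<star> q" "V \<star> q \<sharp> K \<star> l" "V \<star> p \<sharp> K \<star> l"
    using pt_npar2 C n npar_sym by metis+
  then obtain Y where Y: "Y \<in> C" "V \<star> p \<in> Y" "V \<star> q \<in> Y" "K \<star> l \<in> Y" using circle3 by metis
  have "V \<star> p \<noteq> K \<star> l" "V \<star> q \<noteq> V \<star> p" "V \<star> q \<noteq> Y \<star> l'" "V \<star> p \<noteq> Y \<star> l'"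
    using npar_ne pt_npar2 C Y n npar_sym by metis+
  note d = this
  have VY: "V \<noteq> Y" using tan_other[of V K "V \<star> p" "K \<star> l"] t ne d Y C P pt_mem by metis
  have "Y \<star> l' \<notin> V"
    using circle3_unique[of V Y "V \<star> p" "V \<star> q" "Y \<star> l'"] VY C Y P pt_mem d by metis
  obtain D where D: "D \<in> C" "tangent_at V D (V \<star> q)" "Y \<star> l' \<in> D"
    using tan_exists[of V "V \<star> q" "Y \<star> l'"] C Y P pt_mem pt_npar2 n npar_sym by metis
  have Dl: "D \<star> l' = Y \<star> l'" using pt_unique D pt_eqv Y P by metis
  have DV: "D \<noteq> V" using D \<open>Y \<star> l' \<notin> V\<close> by blast
  have BD: "polar l l' K D"
    using polar_concyclic2[of V K D p q l l' Y] C D n npar_sym t Y Dl pt_mem P by metis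
  obtain Z' where Z': "Z' \<in> C" "V \<star> l \<in> Z'" "V \<star> l' \<in> Z'" "D \<star> p \<in> Z'" "K \<star> q \<in> Z'"
    using polar_cross1[OF C(1,2) D(1) n t(1) D(2) ne(1) DV BD] by blast
  have "V \<star> l \<noteq> V \<star> l'" "V \<star> l \<noteq> K \<star> q" "V \<star> l' \<noteq> K \<star> q" using npar_ne pt_npar2 C n by metis+
  then have "Z = Z'" using circle3_unique[of Z Z' "V \<star> l" "V \<star> l'" "K \<star> q"] Z Z' by metis
  then have "D \<star> p = L \<star> p" using circle_eqv_eq[of Z] Z Z' pt_eqv D C P eqv_sym eqv_trans by meson
  moreover have "V \<star> q \<noteq> L \<star> p" using npar_ne pt_npar2 C n npar_sym by metis
  ultimately have "D = L"
    using tan_unique[of V D L "V \<star> q" "L \<star> p"] C D t pt_mem P by metis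
  then show ?thesis using BD by simp
qed

text \<open>The limiting case \<open>l = l'\<close>. If the circle through
  \<open>V \<star> l\<close>, \<open>L \<star> p\<close>, \<open>K \<star> q\<close> met
  \<open>V\<close> in a second point \<open>w\<close>, \<open>polar_cross2\<close> would give
  \<open>polar l w K L\<close>; together with a common point on \<open>l\<close> this makes
  \<open>K\<close> and \<open>L\<close> tangent.\<close>

lemma common_point_cross1:
  assumes C: "V \<in> C" "K \<in> C" "L \<in> C" and n: "p \<sharp> q" "l \<sharp> p" "l \<sharp> q"
    and t: "tangent_at V K (V \<star> p)" "tangent_at V L (V \<star> q)" and ne: "K \<noteq> V" "L \<noteq> V"
    and e: "K \<star> l = L \<star> l"
  shows "copencil V (V \<star> l) (V \<star> l) (L \<star> p) (K \<star> q)"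
proof -
  have P: "p \<in> P" "q \<in> P" "l \<in> P" using n npar_P by metis+
  note tp = touching_pair[OF C n(1) t ne]
  have nn: "V \<star> l \<sharp> L \<star> p" "L \<star> p \<sharp> K \<star> q" "V \<star> l \<sharp> K \<star> q" using pt_npar2 C n by metis+
  then obtain M where M: "M \<in> C" "V \<star> l \<in> M" "L \<star> p \<in> M" "K \<star> q \<in> M" using circle3 by metis
  obtain w where w: "V \<inter> M = {V \<star> l, w}"
    using int_pair[of V M "V \<star> l"] C M pt_mem P tp(6) by metis
  then have wm: "w \<in> V" "w \<in> M" by blast+
  have "w = V \<star> l"
  proof (rule ccontr)
    assume wl: "w \<noteq> V \<star> l"
    have wp: "w \<sharp> L \<star> p" "w \<sharp> K \<star> q" using circle_npar M wm tp(6,7) by metis+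
    have "w \<sharp> p" "w \<sharp> q" using wp npar_cong2 pt_eqv C P eqv_sym by metis+
    moreover have "l \<sharp> w"
      using circle_npar[of V "V \<star> l" w] C wm wl P pt_mem pt_eqv npar_cong1 eqv_sym by metis
    ultimately have "polar l w K L"
      using polar_cross2[of V K L p q l w M] C n t ne M wm pt_id by metis
    then show False
      using polar_same_point[of K L l w] C \<open>l \<sharp> w\<close> e pt_mem P tp(1) by metis
  qed
  then show ?thesis using M w unfolding copencil_def by metis
qed

lemma polar_exists:
  assumes "K \<in> C" "L \<in> C" "l \<in> P" "K \<star> l \<notin> L"
  shows "\<exists>m\<in>P. l \<sharp> m \<and> polar l m K L"
proof -
  obtain W b where W: "W \<in> C" "tangent_at K W (K \<star> l)" "tangent_at W L b"
    using C_exists[of K L "K \<star> l"] assms pt_mem by metis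
  have b: "b \<in> W" "b \<in> L" "K \<star> l \<in> W" using W tan_mem by metis+
  then have "K \<star> l \<noteq> b" using assms by metis
  then have "K \<star> l \<sharp> b" using circle_npar W b by metis
  then have "l \<sharp> b" using npar_cong1 pt_eqv assms eqv_sym by metis
  moreover have "polar l b K L" using polarI[of W K l L b] W tan_sym pt_id assms b by metis
  ultimately show ?thesis using npar_P by metis
qed

text \<open>Otherwise \<open>l\<close> has a polar partner \<open>m\<close>, and
  \<open>polar_cross1\<close> yields a circle through \<open>V \<star> l\<close>,
  \<open>V \<star> m\<close>, \<open>L \<star> p\<close>, \<open>K \<star> q\<close>. It must be the
  circle from \<open>co\<close>, which meets \<open>V\<close> only in
  \<open>V \<star> l\<close>.\<close>

lemma common_point_cross2:
  assumes C: "V \<in> C" "K \<in> C" "L \<in> C" and n: "p \<sharp> q" "l \<sharp> p" "l \<sharp> q"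
    and t: "tangent_at V K (V \<star> p)" "tangent_at V L (V \<star> q)" and ne: "K \<noteq> V" "L \<noteq> V"
    and co: "copencil V (V \<star> l) (V \<star> l) (L \<star> p) (K \<star> q)"
  shows "K \<star> l = L \<star> l"
proof (rule ccontr)
  assume "K \<star> l \<noteq> L \<star> l"
  have P: "p \<in> P" "q \<in> P" "l \<in> P" using n npar_P by metis+
  note tp = touching_pair[OF C n(1) t ne]
  have Kl: "K \<star> l \<notin> L" using \<open>K \<star> l \<noteq> L \<star> l\<close> pt_unique pt_eqv C P by metis
  then obtain m where m: "m \<in> P" "l \<sharp> m" "polar l m K L" using polar_exists C P by metis
  have LK: "polar m l L K" using m polar_flip by metis
  have "L \<star> m \<notin> K"
  proof
    assume "L \<star> m \<in> K"
    then have "tangent_at L K (L \<star> m)" using polar_same_point[of L K m l] C m LK npar_sym by metis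
    then show False using tp(1) tan_sym by metis
  qed
  \<comment> \<open>Polar partners are unique, and \<open>p\<close>, \<open>q\<close> are already
    partners of each other.\<close>
  have "\<not> m \<simeq> p"
  proof
    assume "m \<simeq> p"
    then have "polar p l L K" using LK pt_cong C unfolding polar_def by metis
    moreover have "polar p q L K" using tp(5) polar_flip by metis
    moreover have "L \<star> p \<notin> K" using \<open>L \<star> m \<notin> K\<close> \<open>m \<simeq> p\<close> pt_cong C by metis
    ultimately have "l \<simeq> q" using polar_unique[of L K p l q] C P by metis
    then show False using n not_npar_eqv by metis
  qed
  moreover have "\<not> m \<simeq> q"
  proof
    assume "m \<simeq> q"
    then have "polar q l L K" using LK pt_cong C unfolding polar_def by metis
    moreover have "polar q p L K" using tp(4) polar_flip by metis
    moreover have "L \<star> q \<notin> K" using \<open>L \<star> m \<notin> K\<close> \<open>m \<simeq> q\<close> pt_cong C by metis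
    ultimately have "l \<simeq> p" using polar_unique[of L K q l p] C P by metis
    then show False using n not_npar_eqv by metis
  qed
  ultimately have mpq: "m \<sharp> p" "m \<sharp> q" using eqv_or_npar m P by metis+
  obtain Z where Z: "Z \<in> C" "V \<star> l \<in> Z" "V \<star> m \<in> Z" "L \<star> p \<in> Z" "K \<star> q \<in> Z"
    using polar_cross1[OF C n(1) m(2) n(2,3) mpq t ne m(3)] by blast
  obtain Y where Y: "Y \<in> C" "V \<inter> Y = {V \<star> l}" "L \<star> p \<in> Y" "K \<star> q \<in> Y"
    using co unfolding copencil_def by auto
  have "V \<star> l \<noteq> L \<star> p" "L \<star> p \<noteq> K \<star> q" "V \<star> l \<noteq> K \<star> q" using npar_ne pt_npar2 C n by metis+
  moreover have "V \<star> l \<in> Y" using Y by blast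
  ultimately have "Z = Y" using circle3_unique[of Z Y "V \<star> l" "L \<star> p" "K \<star> q"] Z Y by metis
  then have "V \<star> m \<in> V \<inter> Y" using Z pt_mem C m by simp
  then have "V \<star> m = V \<star> l" using Y by simp
  moreover have "V \<star> l \<noteq> V \<star> m" using npar_ne pt_npar2 C m by metis
  ultimately show False by simp
qed

end

section \<open>The involution of the generators\<close>

locale two_circles = laguerre_CS +
  fixes K L
  assumes K: "K \<in> C" and L: "L \<in> C" and not_tangent: "\<not> tangent K L"
begin

definition fixed :: "'a \<Rightarrow> bool" where
  "fixed x \<longleftrightarrow> K \<star> x = L \<star> x"

text \<open>An involution of the generators without a common point of \<open>K\<close> and
  \<open>L\<close>, by \<open>polar_exists\<close>, \<open>polar_unique\<close> and
  \<open>polar_swap\<close>. In the model it is conjugacy with respect to the quadratic form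
  \<open>K - L\<close>, whose zeros are the fixed generators.\<close>

definition swapped :: "'a \<Rightarrow> 'a \<Rightarrow> bool" where
  "swapped p q \<longleftrightarrow> p \<sharp> q \<and> polar p q K L"

text \<open>For swapped \<open>l\<close>, \<open>l'\<close> the point \<open>L \<star> l'\<close> is
  \<open>kKL\<close> with \<open>k = K \<star> l\<close>, so \<open>s'\<close> is the candidate
  image of \<open>s\<close> computed from this \<open>k\<close>.\<close>

definition linked :: "'a \<Rightarrow> 'a \<Rightarrow> 'a \<Rightarrow> 'a \<Rightarrow> bool" where
  "linked l l' s s' \<longleftrightarrow> (\<exists>Z\<in>C. K \<star> l \<in> Z \<and> L \<star> l' \<in> Z \<and> s \<in> Z \<and> s' \<in> Z)"

lemma not_tan: "\<not> tangent_at K L z"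
  using not_tangent unfolding tangent_def by blast

lemma swapped_npar: "swapped p q \<Longrightarrow> p \<sharp> q" "swapped p q \<Longrightarrow> q \<sharp> p" "swapped p q \<Longrightarrow> p \<in> P" "swapped p q \<Longrightarrow> q \<in> P"
  unfolding swapped_def using npar_sym npar_P by blast+

lemma swapped_sym: "swapped p q \<Longrightarrow> swapped q p"
  unfolding swapped_def using polar_swap K L npar_sym by blast

lemma fixed_iff: "x \<in> P \<Longrightarrow> fixed x \<longleftrightarrow> K \<star> x \<in> L"
  unfolding fixed_def using pt_mem pt_eqv pt_unique K L by metis

lemma fixed_cong: "x \<simeq> y \<Longrightarrow> fixed x \<longleftrightarrow> fixed y"
  unfolding fixed_def using pt_cong K L by metis

lemma swapped_cong: "swapped p q \<Longrightarrow> p \<simeq> p' \<Longrightarrow> q \<simeq> q' \<Longrightarrow> swapped p' q'"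
  unfolding swapped_def polar_def using npar_cong pt_cong K L by metis

lemma swapped_not_fixed: "swapped p q \<Longrightarrow> \<not> fixed p" "swapped p q \<Longrightarrow> \<not> fixed q"
proof -
  have *: "\<not> fixed p" if "swapped p q" for p q
    using that polar_same_point[OF K L] not_tan fixed_iff swapped_npar unfolding swapped_def by metis
  show "swapped p q \<Longrightarrow> \<not> fixed p" using * .
  show "swapped p q \<Longrightarrow> \<not> fixed q" using * swapped_sym by blast
qed

lemma swapped_exists: "x \<in> P \<Longrightarrow> \<not> fixed x \<Longrightarrow> \<exists>y. swapped x y"
  unfolding swapped_def using polar_exists[OF K L] fixed_iff by blast

lemma swapped_unique: "swapped p q \<Longrightarrow> swapped p q' \<Longrightarrow> q \<simeq> q'"
  using polar_unique[OF K L] swapped_npar swapped_not_fixed fixed_iff unfolding swapped_def by metis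

lemma swapped_npar4:
  assumes "swapped p q" "swapped l l'" "l \<sharp> p" "l \<sharp> q"
  shows "l' \<sharp> p" "l' \<sharp> q"
proof -
  have P: "p \<in> P" "q \<in> P" "l \<in> P" "l' \<in> P" using assms swapped_npar by metis+
  have "\<not> l' \<simeq> p"
  proof
    assume "l' \<simeq> p"
    then have "swapped p l" using swapped_cong swapped_sym assms eqv_refl P by metis
    then show False using swapped_unique assms not_npar_eqv eqv_sym by metis
  qed
  moreover have "\<not> l' \<simeq> q"
  proof
    assume "l' \<simeq> q"
    then have "swapped q l" using swapped_cong swapped_sym assms eqv_refl P by metis
    then show False using swapped_unique assms not_npar_eqv eqv_sym swapped_sym by metis
  qed
  ultimately show "l' \<sharp> p" "l' \<sharp> q" using eqv_or_npar P by metis+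
qed

lemma fixed_npar: "fixed z \<Longrightarrow> z \<in> P \<Longrightarrow> swapped p q \<Longrightarrow> z \<sharp> p \<and> z \<sharp> q"
  using fixed_cong swapped_not_fixed eqv_or_npar swapped_npar by metis

lemma swapped_circle:
  assumes "swapped p q"
  obtains V where "V \<in> C" "tangent_at V K (K \<star> p)" "tangent_at V L (L \<star> q)"
    "V \<star> p = K \<star> p" "V \<star> q = L \<star> q" "V \<noteq> K" "V \<noteq> L"
proof -
  obtain V where V: "V \<in> C" "tangent_at V K (K \<star> p)" "tangent_at V L (L \<star> q)"
    using assms unfolding swapped_def polar_def by blast
  have "V \<star> p = K \<star> p" "V \<star> q = L \<star> q"
    using pt_unique[of V "K \<star> p" p] pt_unique[of V "L \<star> q" q] V K L tan_mem pt_eqv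
      swapped_npar assms by metis+
  moreover have "V \<noteq> K" "V \<noteq> L" using V not_tan tan_sym by metis+
  ultimately show thesis using that V by blast
qed

text \<open>\<open>V\<close> is tied to the generators of \<open>s\<close> and \<open>s'\<close> and
  not to \<open>l\<close>, \<open>l'\<close>, so links made from different pairs become maps of one
  family over \<open>V\<close>.\<close>

lemma linked_iff_base:
  assumes "swapped p q" "swapped l l'" "l \<sharp> p" "l \<sharp> q" "s \<simeq> p" "s' \<simeq> q"
    and V: "V \<in> C" "tangent_at V K (K \<star> p)" "tangent_at V L (L \<star> q)"
  shows "linked l l' s s' \<longleftrightarrow> (\<exists>Z\<in>C. V \<star> l \<in> Z \<and> V \<star> l' \<in> Z \<and> s \<in> Z \<and> s' \<in> Z)"
proof -
  obtain W where W: "W \<in> C" "tangent_at W K (K \<star> l)" "tangent_at W L (L \<star> l')"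
    using swapped_circle assms(2) by metis
  show ?thesis unfolding linked_def
    using concyclic_transfer[of V W K L p q l l' s s'] V W K L assms swapped_npar swapped_npar4 by metis
qed

text \<open>By \<open>polar_cross1\<close> the value at \<open>L \<star> p\<close> is the same for
  all pairs \<open>l\<close>, \<open>l'\<close>. This is the point of agreement that
  \<open>copencil_determined\<close> requires.\<close>

lemma base_agree:
  assumes "swapped p q" "swapped l l'" "l \<sharp> p" "l \<sharp> q"
    and V: "V \<in> C" "tangent_at V K (K \<star> p)" "tangent_at V L (L \<star> q)"
  shows "copencil V (V \<star> l) (V \<star> l') (L \<star> p) (K \<star> q)" "L \<star> p \<notin> V"
proof -
  have P: "p \<in> P" "q \<in> P" "l \<in> P" "l' \<in> P" using assms swapped_npar by metis+
  have Vp: "V \<star> p = K \<star> p" "V \<star> q = L \<star> q"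
    using pt_unique[of V "K \<star> p" p] pt_unique[of V "L \<star> q" q] V K L tan_mem pt_eqv P by metis+
  have ne: "K \<noteq> V" "L \<noteq> V" using V not_tan tan_sym by metis+
  have n: "p \<sharp> q" "l \<sharp> l'" "l' \<sharp> p" "l' \<sharp> q" using swapped_npar swapped_npar4 assms by metis+
  have t: "tangent_at V K (V \<star> p)" "tangent_at V L (V \<star> q)" using V Vp by simp_all
  show "L \<star> p \<notin> V" using touching_pair(6)[OF V(1) K L n(1) t ne] .
  moreover have "V \<star> l \<noteq> V \<star> l'" using npar_ne pt_npar2 V n by metis
  moreover have "\<exists>Z\<in>C. V \<star> l \<in> Z \<and> V \<star> l' \<in> Z \<and> L \<star> p \<in> Z \<and> K \<star> q \<in> Z"
    using polar_cross1[OF V(1) K L n(1,2) assms(3,4) n(3,4) t ne] assms(2) unfolding swapped_def by blast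
  ultimately show "copencil V (V \<star> l) (V \<star> l') (L \<star> p) (K \<star> q)"
    using copencil_concyclic V pt_mem P by metis
qed

lemma base_agree_fixed:
  assumes "swapped p q" "fixed z" "z \<in> P"
    and V: "V \<in> C" "tangent_at V K (K \<star> p)" "tangent_at V L (L \<star> q)"
  shows "copencil V (V \<star> z) (V \<star> z) (L \<star> p) (K \<star> q)"
proof -
  have P: "p \<in> P" "q \<in> P" using assms swapped_npar by metis+
  have Vp: "V \<star> p = K \<star> p" "V \<star> q = L \<star> q"
    using pt_unique[of V "K \<star> p" p] pt_unique[of V "L \<star> q" q] V K L tan_mem pt_eqv P by metis+
  have ne: "K \<noteq> V" "L \<noteq> V" using V not_tan tan_sym by metis+
  have t: "tangent_at V K (V \<star> p)" "tangent_at V L (V \<star> q)" using V Vp by simp_all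
  show ?thesis
    using common_point_cross1[OF V(1) K L _ _ _ t ne] fixed_npar assms swapped_npar
    unfolding fixed_def by metis
qed

lemma linked_base:
  assumes "swapped p q" "swapped l l'" "l \<sharp> p" "l \<sharp> q" "s \<simeq> p" "s' \<simeq> q" "linked l l' s s'"
    and V: "V \<in> C" "tangent_at V K (K \<star> p)" "tangent_at V L (L \<star> q)" and s: "s \<notin> V"
  shows "copencil V (V \<star> l) (V \<star> l') s s'"
proof -
  have P: "p \<in> P" "q \<in> P" "l \<in> P" "l' \<in> P" using assms swapped_npar by metis+
  have "V \<star> l \<noteq> V \<star> l'" using npar_ne pt_npar2 V swapped_npar assms by metis
  then show ?thesis using copencil_concyclic[OF V(1) _ _ _ s] linked_iff_base[OF assms(1-6) V] assms(7)
      pt_mem V P by metis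
qed

text \<open>Over \<open>V\<close> both links are pencil maps, and they agree at
  \<open>L \<star> p\<close> by \<open>base_agree\<close>; \<open>copencil_determined\<close>
  carries the agreement to \<open>s\<close>.\<close>

lemma linked_independent:
  assumes "swapped p q" "swapped l l'" "l \<sharp> p" "l \<sharp> q" "swapped m m'" "m \<sharp> p" "m \<sharp> q" "s \<simeq> p" "s' \<simeq> q"
    "linked l l' s s'"
  shows "linked m m' s s'"
proof -
  obtain V where V: "V \<in> C" "tangent_at V K (K \<star> p)" "tangent_at V L (L \<star> q)"
    using swapped_circle assms(1) by metis
  have P: "p \<in> P" "q \<in> P" "l \<in> P" "l' \<in> P" "m \<in> P" "m' \<in> P" using assms swapped_npar by metis+
  note n4 = swapped_npar4[OF assms(1-4)] swapped_npar4[OF assms(1,5-7)]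
  have Vm: "V \<star> l \<in> V" "V \<star> l' \<in> V" "V \<star> m \<in> V" "V \<star> m' \<in> V" using pt_mem V P by metis+
  show ?thesis
  proof (cases "s \<in> V")
    \<comment> \<open>Pencil maps are considered only off \<open>V\<close>. For \<open>s\<close> on
      \<open>V\<close> the circle of the link is \<open>V\<close> itself, whichever pair is
      used.\<close>
    case True
    obtain Z where Z: "Z \<in> C" "V \<star> l \<in> Z" "V \<star> l' \<in> Z" "s \<in> Z" "s' \<in> Z"
      using linked_iff_base[OF assms(1-4,8,9) V] assms(10) by blast
    have "V \<star> l \<noteq> V \<star> l'" using npar_ne pt_npar2 V swapped_npar assms by metis
    moreover have "V \<star> l \<noteq> s" "V \<star> l' \<noteq> s" using npar_ne pt_npar V npar_cong2 assms n4 by metis+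
    ultimately have "Z = V" using circle3_unique[of Z V "V \<star> l" "V \<star> l'" s] Z V Vm True by metis
    then show ?thesis
      using linked_iff_base[OF assms(1,5-9) V] Z Vm by metis
  next
    case False
    have "copencil V (V \<star> m) (V \<star> m') s s'"
    proof (rule copencil_determined[OF V(1) Vm, of p q "L \<star> p" s "K \<star> q" s'])
      show "copencil V (V \<star> l) (V \<star> l') (L \<star> p) (K \<star> q)" "L \<star> p \<notin> V"
        using base_agree[OF assms(1-4) V] .
      show "copencil V (V \<star> m) (V \<star> m') (L \<star> p) (K \<star> q)"
        using base_agree[OF assms(1,5-7) V] by simp
      show "copencil V (V \<star> l) (V \<star> l') s s'"
        using linked_base[OF assms(1-4,8-10) V False] .
    qed (use False assms n4 pt_npar V pt_eqv K L P swapped_npar in metis)+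
    then have "\<exists>Z\<in>C. V \<star> m \<in> Z \<and> V \<star> m' \<in> Z \<and> s \<in> Z \<and> s' \<in> Z" unfolding copencil_def by blast
    then show ?thesis using linked_iff_base[OF assms(1,5-9) V] by blast
  qed
qed

text \<open>The tangent pencil at a fixed generator belongs to the same family and has the same
  value at \<open>L \<star> p\<close>. This brings in the fixed generators, which have no partner
  and so never enter a link.\<close>

lemma linked_fixed:
  assumes "swapped p q" "swapped l l'" "l \<sharp> p" "l \<sharp> q" "s \<simeq> p" "s' \<simeq> q" "linked l l' s s'"
    and V: "V \<in> C" "tangent_at V K (K \<star> p)" "tangent_at V L (L \<star> q)" and s: "s \<notin> V"
    and z: "fixed z" "z \<in> P"
  shows "copencil V (V \<star> z) (V \<star> z) s s'"
proof -
  have P: "p \<in> P" "q \<in> P" "l \<in> P" "l' \<in> P" using assms swapped_npar by metis+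
  note n4 = swapped_npar4[OF assms(1-4)]
  have nz: "z \<sharp> p" "z \<sharp> q" using fixed_npar[OF z assms(1)] by blast+
  have Vm: "V \<star> l \<in> V" "V \<star> l' \<in> V" "V \<star> z \<in> V" using pt_mem V P z by metis+
  show ?thesis
  proof (rule copencil_determined[OF V(1) Vm(1,2,3,3), of p q "L \<star> p" s "K \<star> q" s'])
    show "copencil V (V \<star> l) (V \<star> l') (L \<star> p) (K \<star> q)" "L \<star> p \<notin> V"
      using base_agree[OF assms(1-4) V] .
    show "copencil V (V \<star> z) (V \<star> z) (L \<star> p) (K \<star> q)"
      using base_agree_fixed[OF assms(1) z V] .
    show "copencil V (V \<star> l) (V \<star> l') s s'"
      using linked_base[OF assms(1-7) V s] .
  qed (use s assms n4 nz pt_npar V pt_eqv K L P swapped_npar in metis)+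
qed

lemma linked_sym: "linked l l' s s' \<longleftrightarrow> linked l l' s' s"
  unfolding linked_def by blast

lemma linked_exists:
  assumes "swapped l l'" "l \<sharp> s" "l' \<sharp> s" "q \<in> P"
  shows "\<exists>s'. s' \<simeq> q \<and> linked l l' s s'"
proof -
  have "K \<star> l \<sharp> L \<star> l'" "L \<star> l' \<sharp> s" "K \<star> l \<sharp> s" using pt_npar2 pt_npar K L assms swapped_npar by metis+
  then obtain Z where "Z \<in> C" "K \<star> l \<in> Z" "L \<star> l' \<in> Z" "s \<in> Z" using circle3 by metis
  then show ?thesis using pt_mem pt_eqv assms unfolding linked_def by metis
qed

lemma linked_unique:
  assumes "swapped l l'" "l \<sharp> s" "l' \<sharp> s" "s' \<simeq> s''" "linked l l' s s'" "linked l l' s s''"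
  shows "s' = s''"
proof -
  have "K \<star> l \<noteq> L \<star> l'" "L \<star> l' \<noteq> s" "K \<star> l \<noteq> s"
    using npar_ne pt_npar2 pt_npar K L assms swapped_npar by metis+
  then show ?thesis
    using assms circle3_unique circle_eqv_eq unfolding linked_def by metis
qed

lemma not_fixed_exists: "\<exists>p\<in>P. \<not> fixed p"
proof (rule ccontr)
  assume "\<not> ?thesis"
  then have "x \<in> L" if "x \<in> K" for x
    using that fixed_iff circle_sub K pt_id by metis
  then have "K = L" using circle_subset_eq K L by blast
  moreover obtain x where "x \<in> P" using ax_rich circle_sub by blast
  then have "K \<star> x \<in> K" using pt_mem K by metis
  ultimately show False using not_tan tan_refl by metis
qed

lemma xKL_eq:
  assumes "x \<in> K" "x \<notin> L" "V \<in> C" "tangent_at V K x" "tangent_at V L y"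
  shows "xKL C x K L = y"
proof -
  have VL: "V \<noteq> L" using assms tan_mem by metis
  then have i: "V \<inter> L = {y}" using assms tan_int by metis
  have "(THE M. M \<in> pencil C x K \<and> card (M \<inter> L) = 1) = V"
  proof (rule the1_equality)
    show "\<exists>!M. M \<in> pencil C x K \<and> card (M \<inter> L) = 1"
      using axC[unfolded axiom_C_def, rule_format, OF K L] assms by simp
    show "V \<in> pencil C x K \<and> card (V \<inter> L) = 1"
      using assms i unfolding pencil_def by simp
  qed
  then show ?thesis using assms i unfolding xKL_def by simp
qed

end

section \<open>The reflection when two pairs of generators are moved\<close>

text \<open>\<open>many\<close> provides, for every moved pair of generators, a second moved pair
  disjoint from it, from which the reflection on the first pair is computed.\<close>

locale two_circles_many = two_circles +
  assumes many: "swapped p q \<Longrightarrow> \<exists>l l'. swapped l l' \<and> l \<sharp> p \<and> l \<sharp> q"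
begin

text \<open>\<open>fixed x\<close> is a property of the generator, so fixed generators are fixed
  pointwise. Elsewhere \<open>linked_independent\<close> shows that the bound \<open>l\<close>,
  \<open>l'\<close> do not affect the described point.\<close>

definition reflect :: "'a \<Rightarrow> 'a" where
  "reflect x = (if fixed x then x else
     (THE y. \<exists>q l l'. swapped x q \<and> swapped l l' \<and> l \<sharp> x \<and> l \<sharp> q \<and> y \<simeq> q \<and> linked l l' x y))"

lemma reflect_fixed: "fixed x \<Longrightarrow> reflect x = x"
  unfolding reflect_def by simp

lemma reflect_eqI:
  assumes "swapped x q" "swapped l l'" "l \<sharp> x" "l \<sharp> q" "y \<simeq> q" "linked l l' x y"
  shows "reflect x = y"
proof -
  have "(THE y. \<exists>q l l'. swapped x q \<and> swapped l l' \<and> l \<sharp> x \<and> l \<sharp> q \<and> y \<simeq> q \<and> linked l l' x y) = y"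
  proof (rule the_equality)
    show "\<exists>q l l'. swapped x q \<and> swapped l l' \<and> l \<sharp> x \<and> l \<sharp> q \<and> y \<simeq> q \<and> linked l l' x y"
      using assms by blast
    fix z assume "\<exists>q l l'. swapped x q \<and> swapped l l' \<and> l \<sharp> x \<and> l \<sharp> q \<and> z \<simeq> q \<and> linked l l' x z"
    then obtain q' m m' where m: "swapped x q'" "swapped m m'" "m \<sharp> x" "m \<sharp> q'" "z \<simeq> q'" "linked m m' x z"
      by blast
    have qq: "q' \<simeq> q" using swapped_unique assms m by metis
    have mq: "m \<sharp> q" "z \<simeq> q" using m qq npar_cong2 eqv_sym eqv_trans by metis+
    have "linked l l' x z"
      using linked_independent[OF assms(1) m(2,3) mq(1) assms(2-4) _ mq(2) m(6)]
        eqv_refl swapped_npar assms by metis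
    moreover have "z \<simeq> y" using mq assms eqv_sym eqv_trans by metis
    ultimately show "z = y" using linked_unique assms swapped_npar4 by metis
  qed
  moreover have "\<not> fixed x" using swapped_not_fixed assms by metis
  ultimately show ?thesis unfolding reflect_def by simp
qed

lemma reflect_eqv:
  assumes "swapped x q"
  shows "reflect x \<simeq> q"
proof -
  obtain l l' where l: "swapped l l'" "l \<sharp> x" "l \<sharp> q" using many assms by blast
  have "l' \<sharp> x" using swapped_npar4 assms l by metis
  then obtain y where "y \<simeq> q" "linked l l' x y" using linked_exists l assms swapped_npar by metis
  then show ?thesis using reflect_eqI assms l by metis
qed

lemma reflect_linked:
  assumes "swapped x q" "swapped l l'" "l \<sharp> x" "l \<sharp> q"
  shows "linked l l' x (reflect x)"
proof -
  have "l' \<sharp> x" using swapped_npar4 assms by metis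
  then obtain y where "y \<simeq> q" "linked l l' x y" using linked_exists assms swapped_npar by metis
  then show ?thesis using reflect_eqI assms by metis
qed

lemma swapped_reflect: "x \<in> P \<Longrightarrow> \<not> fixed x \<Longrightarrow> swapped x (reflect x)"
  using swapped_exists reflect_eqv swapped_cong eqv_refl eqv_sym by metis

lemma reflect_P: "x \<in> P \<Longrightarrow> reflect x \<in> P"
  using swapped_reflect swapped_npar reflect_fixed by metis

lemma reflect_reflect:
  assumes "x \<in> P"
  shows "reflect (reflect x) = x"
proof (cases "fixed x")
  case True then show ?thesis using reflect_fixed by metis
next
  case False
  then have s: "swapped x (reflect x)" using swapped_reflect assms by metis
  then obtain l l' where l: "swapped l l'" "l \<sharp> x" "l \<sharp> reflect x" using many by blast
  then have "linked l l' (reflect x) x" using reflect_linked s linked_sym by metis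
  then show ?thesis using reflect_eqI[of "reflect x" x l l' x] s swapped_sym l eqv_refl assms by metis
qed

lemma reflect_nonfixed: "x \<in> P \<Longrightarrow> reflect x = x \<longleftrightarrow> fixed x"
  using reflect_fixed swapped_reflect swapped_npar npar_ne by metis

lemma reflect_K:
  assumes "x \<in> K"
  shows "reflect x = xKL C x K L"
proof -
  have P: "x \<in> P" "K \<star> x = x" using circle_sub K assms pt_id by metis+
  show ?thesis
  proof (cases "fixed x")
    case True
    then have "x \<in> L" using fixed_iff P by metis
    then show ?thesis using reflect_fixed True unfolding xKL_def by simp
  next
    case False
    then obtain q where q: "swapped x q" using swapped_exists P by metis
    obtain V where V: "V \<in> C" "tangent_at V K (K \<star> x)" "tangent_at V L (L \<star> q)"
      using swapped_circle q by metis
    have "xKL C x K L = L \<star> q" using xKL_eq[of x V] assms V P False fixed_iff by metis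
    moreover have "reflect x = L \<star> q"
    proof -
      obtain l l' where l: "swapped l l'" "l \<sharp> x" "l \<sharp> q" using many q by blast
      obtain W where W: "W \<in> C" "tangent_at W K (K \<star> l)" "tangent_at W L (L \<star> l')"
        using swapped_circle l by metis
      \<comment> \<open>(S) for the chain \<open>K\<close>, \<open>W\<close>, \<open>L\<close>,
        \<open>V\<close>: \<open>x\<close> and \<open>L \<star> q\<close> are the contact points of
        \<open>V\<close>, while \<open>K \<star> l\<close> and \<open>L \<star> l'\<close> are those
        of \<open>W\<close>.\<close>
      have "linked l l' x (L \<star> q)" unfolding linked_def
        using cross_concyclic[OF K L W(1) V(1) not_tan W(2,3) V(2,3) l(3)] P by metis
      then show ?thesis using reflect_eqI q l pt_eqv L swapped_npar by metis
    qed
    ultimately show ?thesis by simp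
  qed
qed

text \<open>Each pair is linked through the points of \<open>K\<close> and \<open>L\<close> on the
  generators of the other pair; \<open>concyclic_exchange\<close> eliminates those points.\<close>

lemma reflect_concyclic:
  assumes "swapped t t'" "swapped s s'" "s \<sharp> t" "s \<sharp> t'"
  shows "\<exists>Z\<in>C. t \<in> Z \<and> reflect t \<in> Z \<and> s \<in> Z \<and> reflect s \<in> Z"
proof -
  note n4 = swapped_npar4[OF assms]
  have n: "t \<sharp> s" "t \<sharp> s'" using assms n4 npar_sym by metis+
  obtain V where V: "V \<in> C" "tangent_at V K (K \<star> t)" "tangent_at V L (L \<star> t')"
    using swapped_circle assms(1) by metis
  obtain W where W: "W \<in> C" "tangent_at W K (K \<star> s)" "tangent_at W L (L \<star> s')"
    using swapped_circle assms(2) by metis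
  obtain Z1 where Z1: "Z1 \<in> C" "K \<star> s \<in> Z1" "L \<star> s' \<in> Z1" "t \<in> Z1" "reflect t \<in> Z1"
    using reflect_linked[OF assms] unfolding linked_def by blast
  obtain Z2 where Z2: "Z2 \<in> C" "K \<star> t \<in> Z2" "L \<star> t' \<in> Z2" "s \<in> Z2" "reflect s \<in> Z2"
    using reflect_linked[OF assms(2,1) n] unfolding linked_def by blast
  show ?thesis
    using concyclic_exchange[OF V(1) W(1) K L swapped_npar(1)[OF assms(1)] swapped_npar(1)[OF assms(2)]
        assms(3,4) n4 V(2,3) W(2,3) _ _ _ _ Z1 Z2] eqv_refl reflect_eqv swapped_npar assms by metis
qed

lemma reflect_invariant:
  assumes M: "M \<in> C" "t \<in> M" "reflect t \<in> M" "\<not> fixed t" and s: "s \<in> M"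
  shows "reflect s \<in> M"
proof (cases "fixed s")
  case True then show ?thesis using reflect_fixed s by metis
next
  case False
  have P: "s \<in> P" "t \<in> P" using circle_sub M s by metis+
  have t: "swapped t (reflect t)" using swapped_reflect M P by metis
  have ss: "swapped s (reflect s)" using swapped_reflect False P by metis
  show ?thesis
  proof (cases "s = t \<or> s = reflect t")
    case True then show ?thesis using M reflect_reflect P by metis
  next
    case False
    then have "s \<sharp> t" "s \<sharp> reflect t" using circle_npar M s by metis+
    then obtain Z where Z: "Z \<in> C" "t \<in> Z" "reflect t \<in> Z" "s \<in> Z" "reflect s \<in> Z"
      using reflect_concyclic t ss by metis
    moreover have "t \<noteq> reflect t" using t swapped_npar npar_ne by metis
    ultimately have "Z = M" using circle3_unique[of Z M t "reflect t" s] M s False by metis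
    then show ?thesis using Z by metis
  qed
qed

lemma invariant_base:
  assumes N: "N \<in> C" "t \<in> N" "reflect t \<in> N" "\<not> fixed t"
    and l: "l \<in> P" "\<not> fixed l" "l \<sharp> t" "l \<sharp> reflect t"
  shows "N \<star> reflect l = reflect (N \<star> l)"
proof -
  have n: "N \<star> l \<in> N" "N \<star> l \<simeq> l" using pt_mem pt_eqv N l by metis+
  then have nf: "\<not> fixed (N \<star> l)" using fixed_cong l by metis
  have "swapped (N \<star> l) (reflect l)" using swapped_reflect[of l] l n swapped_cong eqv_sym eqv_refl swapped_npar by metis
  then have "reflect (N \<star> l) \<simeq> reflect l" using reflect_eqv by metis
  moreover have "reflect (N \<star> l) \<in> N" using reflect_invariant N n by metis
  ultimately show ?thesis using pt_unique N by metis
qed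

text \<open>An invariant circle \<open>N\<close> also serves as base circle: between the generators
  of \<open>t\<close> and \<open>reflect t\<close> the reflection acts as one of its pencil maps, so
  \<open>copencil_determined\<close> applies over \<open>N\<close>.\<close>

lemma invariant_base_Co:
  assumes N: "N \<in> C" "t \<in> N" "reflect t \<in> N" "\<not> fixed t"
    and l: "l \<in> P" "\<not> fixed l" "l \<sharp> t" "l \<sharp> reflect t" and x: "x \<simeq> t" "x \<notin> N"
  shows "copencil N (N \<star> l) (N \<star> reflect l) x (reflect x)"
proof -
  have P: "t \<in> P" "x \<in> P" using x eqv_P by metis+
  have n: "N \<star> l \<in> N" "N \<star> l \<simeq> l" using pt_mem pt_eqv N l by metis+
  then have nf: "\<not> fixed (N \<star> l)" using fixed_cong l by metis
  have nP: "N \<star> l \<in> P" using circle_sub N n by metis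
  have s: "swapped (N \<star> l) (reflect (N \<star> l))" using swapped_reflect nf nP by metis
  have st: "swapped t (reflect t)" using swapped_reflect N P by metis
  have sx: "swapped x (reflect t)" using st swapped_cong x eqv_sym eqv_refl swapped_npar by metis
  have "N \<star> l \<sharp> x" "N \<star> l \<sharp> reflect t" using npar_cong l n x eqv_sym pt_npar N npar_cong2 by metis+
  then obtain Z where Z: "Z \<in> C" "x \<in> Z" "reflect x \<in> Z" "N \<star> l \<in> Z" "reflect (N \<star> l) \<in> Z"
    using reflect_concyclic[OF sx s] by blast
  have e: "N \<star> reflect l = reflect (N \<star> l)" using invariant_base N l by metis
  have "N \<star> l \<noteq> N \<star> reflect l" using e s swapped_npar npar_ne by metis
  then show ?thesis
    using copencil_concyclic[of N "N \<star> l" "N \<star> reflect l" x "reflect x"] N n x Z e pt_mem reflect_P l by metis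
qed

text \<open>The circles through \<open>x\<close>, \<open>reflect x\<close> and the point \<open>y\<close> of \<open>N\<close> on a fixed generator touch
  \<open>N\<close>: otherwise they all would pass through a second point \<open>w\<close> of \<open>N\<close> on the other fixed generator,
  and a circle touching the base circle \<open>V\<close> and passing through \<open>w\<close> gives a contradiction.\<close>

lemma invariant_base_fixed:
  assumes N: "N \<in> C" "t \<in> N" "reflect t \<in> N" "\<not> fixed t"
    and z: "z \<in> P" "fixed z" and x: "x \<simeq> t" "x \<notin> N"
  shows "copencil N (N \<star> z) (N \<star> z) x (reflect x)"
proof -
  define y where "y = N \<star> z"
  have P: "t \<in> P" "x \<in> P" using x eqv_P by metis+
  have yN: "y \<in> N" "y \<simeq> z" unfolding y_def using pt_mem pt_eqv N z by metis+
  have yf: "fixed y" using fixed_cong z yN by metis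
  have yP: "y \<in> P" using yN eqv_P by metis
  have st: "swapped t (reflect t)" using swapped_reflect N P by metis
  have xf: "\<not> fixed x" using N x fixed_cong by metis
  have sx: "swapped x (reflect x)" using swapped_reflect P xf by metis
  have ytx: "y \<sharp> t" "y \<sharp> reflect t" "y \<sharp> x" "y \<sharp> reflect x" using fixed_npar[OF yf yP] st sx by blast+
  obtain Q where Q: "Q \<in> C" "y \<in> Q" "x \<in> Q" "reflect x \<in> Q"
    using circle3[of y x "reflect x"] ytx sx swapped_npar by metis
  obtain w where w: "N \<inter> Q = {y, w}" using int_pair[of N Q y] N Q x yN by metis
  then have wm: "w \<in> N" "w \<in> Q" by blast+
  have "w = y"
  proof (rule ccontr)
    assume wy: "w \<noteq> y"
    have wP: "w \<in> P" using wm circle_sub N by metis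
    have "reflect w \<in> N" "reflect w \<in> Q" using reflect_invariant[of N t w] reflect_invariant[of Q x w] N Q xf wm by metis+
    then have "reflect w = y \<or> reflect w = w" using w by blast
    then have "reflect w = w" using reflect_reflect wP reflect_fixed yf wy by metis
    then have wf: "fixed w" using reflect_nonfixed wP by metis
    have wn: "w \<sharp> t" "w \<sharp> reflect t" "w \<sharp> x" "w \<sharp> reflect x" using fixed_npar[OF wf wP] st sx by blast+
    obtain V where V: "V \<in> C" "tangent_at V K (K \<star> t)" "tangent_at V L (L \<star> reflect t)"
        "V \<star> t = K \<star> t" "V \<star> reflect t = L \<star> reflect t"
      using swapped_circle st by metis
    obtain l l' where l: "swapped l l'" "l \<sharp> t" "l \<sharp> reflect t" using many st by blast
    have Vfix: "copencil V (V \<star> v) (V \<star> v) s (reflect s)"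
      if "s \<simeq> t" "s \<notin> V" "fixed v" "v \<in> P" for s v
    proof -
      have ss: "swapped s (reflect t)" using st swapped_cong that eqv_sym eqv_refl swapped_npar by metis
      have "l \<sharp> s" using npar_cong2 l that by metis
      then have "linked l l' s (reflect s)" using reflect_linked ss l by metis
      then show ?thesis using linked_fixed[OF st l that(1) _ _ V(1-3) that(2-4)] reflect_eqv ss by metis
    qed
    \<comment> \<open>For \<open>s\<close> off \<open>V\<close> this is the tangent pencil of
      \<open>linked_fixed\<close>. For \<open>s\<close> on \<open>V\<close> the image lies on
      \<open>V\<close> as well, so that \<open>R = V\<close>.\<close>
    have touch: "tangent_at V R v"
      if R: "R \<in> C" "v \<in> R" "v \<in> V" "fixed v" "s \<simeq> t" "s \<in> R" "reflect s \<in> R" for R v s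
    proof -
      have vP: "v \<in> P" "s \<in> P" using R circle_sub by metis+
      have Vv: "V \<star> v = v" using pt_id V R by metis
      have sf: "\<not> fixed s" using N R fixed_cong by metis
      have ss: "swapped s (reflect s)" using swapped_reflect vP sf by metis
      have ne: "v \<noteq> s" "v \<noteq> reflect s" "s \<noteq> reflect s"
        using fixed_npar[OF R(4) vP(1) ss] ss npar_ne swapped_npar by metis+
      show ?thesis
      proof (cases "s \<in> V")
        case True
        then have s: "s = V \<star> t" using pt_unique V R by metis
        then have sK: "s \<in> K" using V pt_mem K P by metis
        have "reflect s = L \<star> reflect t"
        proof -
          have ss: "swapped s (reflect t)" using st swapped_cong R eqv_sym eqv_refl swapped_npar by metis
          have "l \<sharp> s" using npar_cong2 l R by metis
          then have "linked l l' s (reflect s)" using reflect_linked ss l by metis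
          then obtain Z where Z: "Z \<in> C" "V \<star> l \<in> Z" "V \<star> l' \<in> Z" "s \<in> Z" "reflect s \<in> Z"
            using linked_iff_base[OF st l R(5) reflect_eqv[OF ss] V(1-3)] by blast
          have n4: "l' \<sharp> t" using swapped_npar4 st l by metis
          have "V \<star> l \<noteq> V \<star> l'" using npar_ne pt_npar2 V swapped_npar l by metis
          moreover have "V \<star> l \<noteq> s" "V \<star> l' \<noteq> s" using npar_ne pt_npar V npar_cong2 l n4 R by metis+
          ultimately have "Z = V"
            using circle3_unique[of Z V "V \<star> l" "V \<star> l'" s] Z V True pt_mem l swapped_npar by metis
          then show ?thesis using pt_unique V Z reflect_eqv ss by metis
        qed
        then have "reflect s \<in> V" using V tan_mem by metis
        then have "R = V" using circle3_unique[of R V v s "reflect s"] R V True ne by metis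
        then show ?thesis using tan_refl R by metis
      next
        case False
        then obtain Y where Y: "Y \<in> C" "V \<inter> Y = {v}" "s \<in> Y" "reflect s \<in> Y"
          using Vfix[OF R(5) False R(4) vP(1)] Vv unfolding copencil_def by auto
        then have "v \<in> Y" by blast
        then have "R = Y" using circle3_unique[of R Y v s "reflect s"] R Y ne by metis
        then show ?thesis using Y unfolding tangent_at_def by blast
      qed
    qed
    \<comment> \<open>\<open>N\<close> and \<open>Q\<close> would both touch \<open>V\<close> at
      \<open>v\<close> and hence each other, although they meet in \<open>y\<close> and
      \<open>w\<close>.\<close>
    have not_both: False if "v \<in> V" "fixed v" "v \<in> N" "v \<in> Q" for v
    proof -
      have "tangent_at V N v" "tangent_at V Q v"
        using touch[of N v t] touch[of Q v x] that N Q x eqv_refl P by metis+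
      then have "tangent_at N Q v" using tan_trans V N Q by metis
      moreover have "N \<noteq> Q" using Q x by metis
      ultimately have "N \<inter> Q = {v}" using tan_int by metis
      then show False using w wy by (metis doubleton_eq_iff insert_absorb2)
    qed
    have yV: "y \<notin> V" using not_both yf yN Q by metis
    have wV: "w \<notin> V" using not_both wf wm by metis
    have "w \<sharp> y" using circle_npar N wm yN wy by metis
    then have "V \<star> z \<sharp> w" using pt_npar npar_cong1 V yN eqv_sym npar_sym by metis
    then obtain R where R: "R \<in> C" "tangent_at V R (V \<star> z)" "w \<in> R"
      using tan_exists[of V "V \<star> z" w] V pt_mem z by metis
    define s where "s = R \<star> t"
    have s: "s \<in> R" "s \<simeq> t" unfolding s_def using pt_mem pt_eqv R P by metis+
    have sP: "s \<in> P" using s eqv_P by metis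
    have zt: "z \<sharp> t" using fixed_npar[OF z(2,1) st] by blast
    have Rz: "V \<star> z \<in> R" using R tan_mem by metis
    have VR: "V \<inter> R = {V \<star> z}" using tan_int R wV by metis
    have "s \<sharp> V \<star> z" using npar_cong1 s zt npar_sym pt_npar' V by metis
    then have sV: "s \<notin> V" using VR s npar_ne by blast
    have sf: "\<not> fixed s" using N s fixed_cong by metis
    have ss: "swapped s (reflect s)" using swapped_reflect sP sf by metis
    have co: "copencil V (V \<star> z) (V \<star> z) s (reflect s)" using Vfix s sV z by metis
    have phR: "reflect s \<in> R"
    proof -
      obtain Y where Y: "Y \<in> C" "V \<inter> Y = {V \<star> z, V \<star> z}" "s \<in> Y" "reflect s \<in> Y"
        using co unfolding copencil_def by blast
      then have "Y = R" using copencil_circle_unique[of V Y R "V \<star> z" "V \<star> z" s] V R VR s sV by auto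
      then show ?thesis using Y by metis
    qed
    have wns: "w \<noteq> s" "w \<noteq> reflect s" "s \<noteq> reflect s"
      using fixed_npar[OF wf wP ss] ss swapped_npar npar_ne by metis+
    have "y \<in> R"
    proof (cases "s \<in> N")
      case True
      then have "s = t" using circle_eqv_eq N s by metis
      then have "R = N"
        using circle3_unique[of R N s "reflect s" w] R N s phR wm wns by metis
      then show ?thesis using yN by metis
    next
      case False
      \<comment> \<open>Over \<open>N\<close> the pencil maps of \<open>y\<close>, \<open>w\<close>
        and of \<open>N \<star> l\<close>, \<open>N \<star> reflect l\<close> agree at
        \<open>x\<close> by the choice of \<open>Q\<close>, hence at \<open>s\<close>. The circle
        obtained shares \<open>s\<close>, \<open>reflect s\<close> and \<open>w\<close> with
        \<open>R\<close>, so \<open>R\<close> contains \<open>y\<close>; but \<open>R\<close>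
        already crosses that generator in \<open>V \<star> z\<close>.\<close>
      have "copencil N y w s (reflect s)"
      proof (rule copencil_determined[of N "N \<star> l" "N \<star> reflect l" y w t "reflect t" x s "reflect x" "reflect s"])
        have lf: "l \<in> P" "\<not> fixed l" using swapped_npar swapped_not_fixed l by metis+
        show "copencil N (N \<star> l) (N \<star> reflect l) x (reflect x)" "copencil N (N \<star> l) (N \<star> reflect l) s (reflect s)"
          using invariant_base_Co[OF N lf l(2,3)] x s False by metis+
        show "copencil N y w x (reflect x)" unfolding copencil_def using w Q by blast
        have lp: "swapped l (reflect l)" using swapped_reflect lf by metis
        have n4: "reflect l \<sharp> t" "reflect l \<sharp> reflect t" using swapped_npar4[OF st lp l(2,3)] by blast+
        show "N \<star> l \<sharp> t" "N \<star> l \<sharp> reflect t" "N \<star> reflect l \<sharp> t" "N \<star> reflect l \<sharp> reflect t"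
          using pt_npar N l n4 by metis+
        show "N \<star> l \<in> N" "N \<star> reflect l \<in> N" using pt_mem N lf reflect_P by metis+
        show "reflect x \<simeq> reflect t" "reflect s \<simeq> reflect t"
          using reflect_eqv[of x "reflect t"] reflect_eqv[of s "reflect t"] st swapped_cong x s eqv_sym eqv_refl swapped_npar
          by metis+
      qed (use N x s False wm yN ytx wn st swapped_npar in metis)+
      then obtain Y where Y: "Y \<in> C" "y \<in> Y" "w \<in> Y" "s \<in> Y" "reflect s \<in> Y"
        unfolding copencil_def by blast
      then have "Y = R" using circle3_unique[of Y R s "reflect s" w] R s phR wns by metis
      then show ?thesis using Y by metis
    qed
    moreover have "y \<simeq> V \<star> z" using yN pt_eqv V z eqv_sym eqv_trans by metis
    ultimately have "y = V \<star> z" using circle_eqv_eq R Rz by metis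
    then show False using yV pt_mem V z by metis
  qed
  then show ?thesis using w Q unfolding copencil_def y_def[symmetric] by auto
qed

text \<open>For non-invariant \<open>M\<close>, the circle \<open>N\<close> touching
  \<open>M\<close> at \<open>t\<close> through \<open>q\<close> is invariant, so the image of
  \<open>M\<close> has to touch \<open>N\<close> at \<open>q\<close>; passing through
  \<open>reflect r\<close> then singles out \<open>M'\<close>. Over the base \<open>N\<close>,
  \<open>polar_cross2\<close> handles the moved points of \<open>M\<close> and
  \<open>common_point_cross2\<close> the fixed ones.\<close>

lemma reflect_circle:
  assumes M: "M \<in> C"
  shows "\<exists>M'\<in>C. \<forall>s\<in>M. reflect s \<in> M'"
proof -
  obtain p where p: "p \<in> P" "\<not> fixed p" using not_fixed_exists by blast
  define t where "t = M \<star> p"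
  have t: "t \<in> M" "t \<in> P" "\<not> fixed t"
    unfolding t_def using pt_mem pt_eqv fixed_cong M p circle_sub by metis+
  define q where "q = reflect t"
  have st: "swapped t q" unfolding q_def using swapped_reflect t by metis
  note tq = swapped_npar[OF st]
  show ?thesis
  proof (cases "q \<in> M")
    case True
    then show ?thesis using reflect_invariant M t unfolding q_def by blast
  next
    case False
    obtain N where N: "N \<in> C" "tangent_at M N t" "q \<in> N"
      using tan_exists[of M t q] M t tq by metis
    have tN: "t \<in> N" using N tan_mem by metis
    have MN: "M \<noteq> N" using N False by metis
    define r where "r = M \<star> q"
    have r: "r \<in> M" "r \<simeq> q" "r \<in> P" unfolding r_def using pt_mem pt_eqv M tq circle_sub by metis+
    have sr: "swapped r t" using swapped_cong[OF swapped_sym[OF st]] r eqv_sym eqv_refl t by metis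
    have r': "reflect r \<simeq> t" using reflect_eqv sr by metis
    have qr: "q \<sharp> reflect r" using npar_cong2 r' tq by metis
    obtain M' where M': "M' \<in> C" "tangent_at N M' q" "reflect r \<in> M'"
      using tan_exists[of N q "reflect r"] N qr by metis
    have "reflect r \<notin> N"
    proof
      assume "reflect r \<in> N"
      then have "reflect r = t" using circle_eqv_eq N tN r' by metis
      then have "r = q" unfolding q_def using reflect_reflect r by metis
      then show False using r False by metis
    qed
    then have M'N: "M' \<noteq> N" using M' by metis
    have Nt: "N \<star> t = t" "N \<star> q = q" using pt_id N tN by metis+
    have M't: "M' \<star> t = reflect r" "M \<star> q = r" using pt_unique M' r' M r by metis+
    have tans: "tangent_at N M (N \<star> t)" "tangent_at N M' (N \<star> q)" using N M' Nt tan_sym by metis+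
    note inv = N(1) tN N(3)[unfolded q_def] t(3)
    have "reflect s \<in> M'" if s: "s \<in> M" for s
    proof -
      have sP: "s \<in> P" using s circle_sub M by metis
      have Ms: "M \<star> s = s" using pt_id M s by metis
      show ?thesis
      proof (cases "fixed s")
        case True
        have "reflect r \<simeq> t" "reflect (reflect r) = r" using r' reflect_reflect r by metis+
        then have "copencil N (N \<star> s) (N \<star> s) (M' \<star> t) (M \<star> q)"
          using invariant_base_fixed[OF inv sP True, of "reflect r"] \<open>reflect r \<notin> N\<close> M't by metis
        moreover have "s \<sharp> t" "s \<sharp> q" using fixed_npar[OF True sP st] by blast+
        ultimately have "M \<star> s = M' \<star> s"
          using common_point_cross2[OF N(1) M M'(1) tq(1) _ _ tans MN M'N] by blast
        then show ?thesis using Ms reflect_fixed True pt_mem M' sP by metis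
      next
        case False
        then have ss: "swapped s (reflect s)" using swapped_reflect sP by metis
        consider "s = t" | "s = r" | "s \<noteq> t" "s \<noteq> r" by blast
        then show ?thesis
        proof cases
          case 1 then show ?thesis using M' tan_mem q_def by metis
        next
          case 2 then show ?thesis using M' by metis
        next
          case 3
          have st': "s \<sharp> t" using circle_npar M s t 3 by metis
          have "s \<sharp> r" using circle_npar M s r 3 by metis
          then have sq: "s \<sharp> q" using npar_cong2 r eqv_sym by metis
          note n4 = swapped_npar4[OF st ss st' sq]
          have Ns: "N \<star> s \<simeq> s" "N \<star> s \<in> P" using pt_eqv N sP eqv_P by metis+
          have "swapped (N \<star> s) (reflect s)" using swapped_cong ss Ns eqv_sym eqv_refl swapped_npar by metis
          moreover have "N \<star> s \<sharp> r" "N \<star> s \<sharp> t" using pt_npar N \<open>s \<sharp> r\<close> st' by metis+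
          ultimately obtain Z where Z: "Z \<in> C" "r \<in> Z" "reflect r \<in> Z" "N \<star> s \<in> Z" "reflect (N \<star> s) \<in> Z"
            using reflect_concyclic[OF sr] by metis
          have "N \<star> reflect s = reflect (N \<star> s)"
            using invariant_base[OF inv sP False st'] sq unfolding q_def by metis
          \<comment> \<open>\<open>M\<close> and \<open>M'\<close> touch \<open>N\<close> on the
            generators of \<open>t\<close> and \<open>q\<close>, and the crosswise points
            \<open>M' \<star> t\<close>, \<open>M \<star> q\<close> are \<open>reflect r\<close> and
            \<open>r\<close>; so \<open>Z\<close> is the circle that \<open>polar_cross2\<close>
            asks for.\<close>
          then have "polar s (reflect s) M M'"
            using polar_cross2[OF N(1) M M'(1) tq(1) swapped_npar(1)[OF ss] st' sq n4 tans MN M'N Z(1)]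
              Z M't by metis
          then obtain Y where Y: "Y \<in> C" "t \<in> Y" "q \<in> Y" "s \<in> Y" "M' \<star> reflect s \<in> Y"
            using polar_concyclic1[OF N(1) M M'(1) tq(1) swapped_npar(1)[OF ss] st' sq n4 tans] Nt Ms by metis
          obtain X where X: "X \<in> C" "t \<in> X" "reflect t \<in> X" "s \<in> X" "reflect s \<in> X"
            using reflect_concyclic[OF st ss st' sq] by blast
          have "X = Y"
            using circle3_unique[of X Y t q s] X Y st' sq tq npar_ne unfolding q_def by metis
          moreover have "M' \<star> reflect s \<simeq> reflect s" using pt_eqv M' ss swapped_npar by metis
          ultimately have "M' \<star> reflect s = reflect s" using circle_eqv_eq X Y by metis
          then show ?thesis using pt_mem M' ss swapped_npar by metis
        qed
      qed
    qed
    then show ?thesis using M' by blast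
  qed
qed

end

section \<open>The reflection when only one pair of generators is moved\<close>

text \<open>\<open>h\<close> is a transposition of three points and \<open>g\<close> a permutation
  disagreeing with it everywhere. Then \<open>g\<close> after the inverse of \<open>h\<close> has no
  fixed point, so it is a 3-cycle and even. Hence \<open>g\<close> is odd, again a
  transposition.\<close>

lemma discordant_transposition:
  assumes d: "a \<noteq> b" "a \<noteq> c" "b \<noteq> c"
    and h: "h a \<in> {a, b, c}" "h b \<in> {a, b, c}" "h c \<in> {a, b, c}"
    and hh: "h (h a) = a" "h (h b) = b" "h (h c) = c" "h a \<noteq> a \<or> h b \<noteq> b \<or> h c \<noteq> c"
    and g: "g a \<in> {a, b, c}" "g b \<in> {a, b, c}" "g c \<in> {a, b, c}"
    and gi: "g a \<noteq> g b" "g a \<noteq> g c" "g b \<noteq> g c"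
    and gh: "g a \<noteq> h a" "g b \<noteq> h b" "g c \<noteq> h c"
  shows "g (g a) = a \<and> g (g b) = b \<and> g (g c) = c \<and> (g a \<noteq> a \<or> g b \<noteq> b \<or> g c \<noteq> c)"
proof -
  have "h a = b \<and> h b = a \<and> h c = c \<or> h a = c \<and> h c = a \<and> h b = b \<or> h b = c \<and> h c = b \<and> h a = a"
    using d h hh by (metis insertE singletonD)
  moreover have "g a = a \<or> g a = b \<or> g a = c" "g b = a \<or> g b = b \<or> g b = c"
      "g c = a \<or> g c = b \<or> g c = c"
    using g by blast+
  ultimately show ?thesis using d gi gh by (elim disjE conjE) simp_all
qed

context two_circles
begin

text \<open>For \<open>x\<close> on \<open>p\<close> off \<open>K\<close> and \<open>L\<close>, the
  circle through \<open>z\<close>, \<open>L \<star> q\<close> and \<open>x\<close> cannot meet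
  \<open>K\<close> again on \<open>p\<close>, \<open>q\<close> or \<open>w\<close>. So it touches
  \<open>K\<close> at \<open>z\<close>, which makes it the circle \<open>R\<close> and determines
  \<open>x\<close>.\<close>

lemma third_point:
  assumes s: "swapped p q" and zw: "K \<inter> L = {z, w}"
    and all: "\<And>x. x \<in> P \<Longrightarrow> x \<simeq> p \<or> x \<simeq> q \<or> x \<simeq> z \<or> x \<simeq> w"
  shows "\<exists>a. a \<simeq> p \<and> a \<noteq> K \<star> p \<and> a \<noteq> L \<star> p \<and> (\<forall>x. x \<simeq> p \<longrightarrow> x = K \<star> p \<or> x = L \<star> p \<or> x = a)"
proof -
  note n = swapped_npar[OF s]
  have z: "z \<in> K" "z \<in> L" "w \<in> K" "w \<in> L" using zw by blast+
  have zP: "z \<in> P" using z circle_sub K by metis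
  have "fixed z" using fixed_iff zP pt_id K z by metis
  then have zp: "z \<sharp> p" "z \<sharp> q" using fixed_npar zP s by metis+
  have zLq: "z \<sharp> L \<star> q" using pt_npar' L zp by metis
  have qK: "L \<star> q \<notin> K" using swapped_not_fixed s pt_unique pt_eqv K L n unfolding fixed_def by metis
  have zwne: "z \<noteq> w" using zw not_tan unfolding tangent_at_def by auto
  obtain R where R: "R \<in> C" "tangent_at K R z" "L \<star> q \<in> R" using tan_exists K z zLq by metis
  have Rz: "z \<in> R" using R tan_mem by metis
  have "z \<noteq> L \<star> q" "z \<noteq> L \<star> p" "z \<noteq> K \<star> p" "L \<star> p \<noteq> L \<star> q" "w \<noteq> L \<star> q"
    using npar_ne zLq pt_npar' pt_npar2 zp n K L pt_mem qK z by metis+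
  note d = this
  have unique: "x = R \<star> p" if x: "x \<simeq> p" "x \<noteq> K \<star> p" "x \<noteq> L \<star> p" for x
  proof -
    have "x \<sharp> z" "x \<sharp> L \<star> q" using npar_cong1 x zp npar_sym pt_npar' L n by metis+
    then obtain M where M: "M \<in> C" "z \<in> M" "L \<star> q \<in> M" "x \<in> M"
      using circle3[of x z "L \<star> q"] zLq by metis
    have "K \<noteq> M" using x M pt_unique by metis
    then obtain i where i: "K \<inter> M = {z, i}" using int_pair[of K M z] K M z by metis
    then have im: "i \<in> K" "i \<in> M" by blast+
    have "\<not> i \<simeq> p" using pt_unique M im K x by metis
    moreover have "\<not> i \<simeq> q"
    proof
      assume "i \<simeq> q"
      then have "i = L \<star> q" using pt_unique M im pt_eqv L n by metis
      then show False using qK im by metis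
    qed
    moreover have "\<not> i \<simeq> w"
    proof
      assume "i \<simeq> w"
      then have "i = w" using circle_eqv_eq K im z by metis
      then have "M = L" using circle3_unique[of M L z w "L \<star> q"] M L im z zwne d pt_mem n by metis
      then show False using x M pt_unique L by metis
    qed
    ultimately have "i = z" using all im circle_sub circle_eqv_eq K z by metis
    then have "tangent_at K M z" using i unfolding tangent_at_def by simp
    then have "M = R" using tan_unique[of K M R z "L \<star> q"] K M R d by metis
    then show ?thesis using pt_unique M x by metis
  qed
  have "R \<star> p \<noteq> K \<star> p"
  proof
    assume "R \<star> p = K \<star> p"
    then have "K = R" using tan_other R pt_mem K n d by metis
    then show False using R qK by metis
  qed
  moreover have "R \<star> p \<noteq> L \<star> p"
  proof
    assume "R \<star> p = L \<star> p"
    then have "R = L"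
      using circle3_unique[of R L z "L \<star> q" "L \<star> p"] R L Rz z d pt_mem n by metis
    then show False using R not_tan by metis
  qed
  moreover have "R \<star> p \<simeq> p" using pt_eqv R n by metis
  ultimately show ?thesis using unique by blast
qed

end

locale two_circles_few = two_circles +
  fixes p q a b z w
  assumes spq: "swapped p q" and zw: "K \<inter> L = {z, w}"
    and all: "\<And>x. x \<in> P \<Longrightarrow> x \<simeq> p \<or> x \<simeq> q \<or> x \<simeq> z \<or> x \<simeq> w"
    and a: "a \<simeq> p" "a \<noteq> K \<star> p" "a \<noteq> L \<star> p" "\<And>x. x \<simeq> p \<Longrightarrow> x = K \<star> p \<or> x = L \<star> p \<or> x = a"
    and b: "b \<simeq> q" "b \<noteq> K \<star> q" "b \<noteq> L \<star> q" "\<And>x. x \<simeq> q \<Longrightarrow> x = K \<star> q \<or> x = L \<star> q \<or> x = b"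
begin

text \<open>The values at \<open>K \<star> p\<close> and \<open>K \<star> q\<close> are forced by
  \<open>xKL\<close>, those at \<open>L \<star> q\<close> and \<open>L \<star> p\<close> by being an
  involution. With the generators of \<open>p\<close> and \<open>q\<close> exchanged, only
  \<open>a\<close> and \<open>b\<close> are left as partners.\<close>

definition reflect :: "'a \<Rightarrow> 'a" where
  "reflect x = (if x = K \<star> p then L \<star> q else if x = L \<star> p then K \<star> q else if x = a then b
    else if x = L \<star> q then K \<star> p else if x = K \<star> q then L \<star> p else if x = b then a else x)"

lemma pq_npar: "p \<sharp> q" "q \<sharp> p" "p \<in> P" "q \<in> P"
  using swapped_npar spq by metis+

lemma distinct6:
  "K \<star> p \<noteq> L \<star> p" "K \<star> q \<noteq> L \<star> q" "K \<star> p \<noteq> K \<star> q" "K \<star> p \<noteq> L \<star> q" "K \<star> p \<noteq> b"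
  "L \<star> p \<noteq> K \<star> q" "L \<star> p \<noteq> L \<star> q" "L \<star> p \<noteq> b" "a \<noteq> K \<star> q" "a \<noteq> L \<star> q" "a \<noteq> b"
proof -
  show "K \<star> p \<noteq> L \<star> p" "K \<star> q \<noteq> L \<star> q" using swapped_not_fixed spq unfolding fixed_def by metis+
  show "K \<star> p \<noteq> K \<star> q" "K \<star> p \<noteq> L \<star> q" "K \<star> p \<noteq> b"
    "L \<star> p \<noteq> K \<star> q" "L \<star> p \<noteq> L \<star> q" "L \<star> p \<noteq> b" "a \<noteq> K \<star> q" "a \<noteq> L \<star> q" "a \<noteq> b"
    using npar_cong[OF pq_npar(1)] pt_eqv K L pq_npar eqv_sym a(1) b(1) npar_ne by metis+
qed

lemma reflect_simps [simp]:
  "reflect (K \<star> p) = L \<star> q" "reflect (L \<star> p) = K \<star> q" "reflect a = b"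
  "reflect (L \<star> q) = K \<star> p" "reflect (K \<star> q) = L \<star> p" "reflect b = a"
  unfolding reflect_def using distinct6 a b by auto

lemma reflect_other:
  assumes "x \<sharp> p" "x \<sharp> q"
  shows "reflect x = x"
proof -
  have "x \<noteq> K \<star> p" "x \<noteq> L \<star> p" "x \<noteq> a" "x \<noteq> L \<star> q" "x \<noteq> K \<star> q" "x \<noteq> b"
    using assms not_npar_eqv a(1) b(1) pt_eqv K L pq_npar by metis+
  then show ?thesis unfolding reflect_def by simp
qed

lemma reflect_p: "x \<simeq> p \<Longrightarrow> reflect x \<simeq> q"
  using a(4) b(1) pt_eqv K L pq_npar reflect_simps by metis

lemma reflect_q: "x \<simeq> q \<Longrightarrow> reflect x \<simeq> p"
  using b(4) a(1) pt_eqv K L pq_npar reflect_simps by metis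

lemma cases4:
  assumes "x \<in> P"
  obtains "x \<simeq> p" | "x \<simeq> q" | "x \<sharp> p" "x \<sharp> q"
  using eqv_or_npar assms pq_npar by metis

lemma reflect_P: "x \<in> P \<Longrightarrow> reflect x \<in> P"
  using cases4 reflect_p reflect_q reflect_other eqv_P by metis

lemma reflect_reflect:
  assumes "x \<in> P"
  shows "reflect (reflect x) = x"
  using assms
proof (cases rule: cases4)
  case 1 then show ?thesis using a(4) reflect_simps by metis
next
  case 2 then show ?thesis using b(4) reflect_simps by metis
next
  case 3 then show ?thesis using reflect_other by metis
qed

lemma zw_facts:
  "z \<in> K" "z \<in> L" "w \<in> K" "w \<in> L" "z \<sharp> w" "z \<sharp> p" "z \<sharp> q" "w \<sharp> p" "w \<sharp> q"
proof -
  show m: "z \<in> K" "z \<in> L" "w \<in> K" "w \<in> L" using zw by blast+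
  have "z \<noteq> w" using zw not_tan unfolding tangent_at_def by auto
  then show "z \<sharp> w" using circle_npar K m by metis
  have "z \<in> P" "w \<in> P" using m circle_sub K by metis+
  moreover from this have "fixed z" "fixed w" using fixed_iff pt_id K m by metis+
  ultimately show "z \<sharp> p" "z \<sharp> q" "w \<sharp> p" "w \<sharp> q" using fixed_npar spq by metis+
qed

section \<open>Return maps on the generator of \<open>p\<close>\<close>

definition circle_through :: "'a \<Rightarrow> 'a \<Rightarrow> 'a \<Rightarrow> 'a set" where
  "circle_through y y' x = (THE M. M \<in> C \<and> y \<in> M \<and> y' \<in> M \<and> x \<in> M)"

lemma npar3:
  assumes "y \<simeq> z" "y' \<simeq> w" "x \<simeq> p"
  shows "y \<sharp> y'" "y' \<sharp> x" "y \<sharp> x"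
  using assms npar_cong zw_facts eqv_sym by metis+

lemma circle_through:
  assumes "y \<simeq> z" "y' \<simeq> w" "x \<simeq> p"
  shows "circle_through y y' x \<in> C" "y \<in> circle_through y y' x" "y' \<in> circle_through y y' x" "x \<in> circle_through y y' x"
  using theI'[OF join_ex1[OF npar3[OF assms]]] unfolding circle_through_def by blast+

lemma circle_through_eq:
  assumes "y \<simeq> z" "y' \<simeq> w" "x \<simeq> p" "M \<in> C" "y \<in> M" "y' \<in> M" "x \<in> M"
  shows "circle_through y y' x = M"
  using the1_equality[OF join_ex1[OF npar3[OF assms(1-3)]], of M] assms unfolding circle_through_def by blast

text \<open>A circle through \<open>y\<close> and \<open>y'\<close> meeting \<open>p\<close> in
  \<open>x\<close> meets \<open>q\<close> in the reflection of \<open>return_map y y' x\<close>. As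
  \<open>y\<close> and \<open>y'\<close> are fixed, reflection preserves the circles through them
  exactly when this map is an involution on the generator of \<open>p\<close>.\<close>

definition return_map :: "'a \<Rightarrow> 'a \<Rightarrow> 'a \<Rightarrow> 'a" where
  "return_map y y' x = reflect (circle_through y y' x \<star> q)"

lemma return_map_p:
  assumes "y \<simeq> z" "y' \<simeq> w" "x \<simeq> p"
  shows "return_map y y' x \<simeq> p" "circle_through y y' x \<star> q = reflect (return_map y y' x)" "circle_through y y' x \<star> q \<in> circle_through y y' x"
    "y \<noteq> circle_through y y' x \<star> q" "y' \<noteq> circle_through y y' x \<star> q" "x \<noteq> circle_through y y' x \<star> q"
proof -
  have e: "circle_through y y' x \<star> q \<simeq> q" using pt_eqv circle_through[OF assms] pq_npar by metis
  then show "return_map y y' x \<simeq> p" unfolding return_map_def using reflect_q by metis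
  show "circle_through y y' x \<star> q = reflect (return_map y y' x)" unfolding return_map_def using reflect_reflect e eqv_P by metis
  show "circle_through y y' x \<star> q \<in> circle_through y y' x" using pt_mem circle_through[OF assms] pq_npar by metis
  have "y \<sharp> circle_through y y' x \<star> q" "y' \<sharp> circle_through y y' x \<star> q" "x \<sharp> circle_through y y' x \<star> q"
    using npar_cong[OF zw_facts(7)] npar_cong[OF zw_facts(9)] npar_cong[OF pq_npar(1)] assms e eqv_sym
    by metis+
  then show "y \<noteq> circle_through y y' x \<star> q" "y' \<noteq> circle_through y y' x \<star> q" "x \<noteq> circle_through y y' x \<star> q"
    using npar_ne by metis+
qed

lemma return_map_inj:
  assumes "y \<simeq> z" "y' \<simeq> w" "x \<simeq> p" "x' \<simeq> p" "return_map y y' x = return_map y y' x'"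
  shows "x = x'"
proof -
  note 1 = circle_through[OF assms(1-3)] return_map_p[OF assms(1-3)] note 2 = circle_through[OF assms(1,2,4)] return_map_p[OF assms(1,2,4)]
  have "y \<noteq> y'" using npar3 npar_ne assms by metis
  then have "circle_through y y' x = circle_through y y' x'"
    using circle3_unique[of "circle_through y y' x" "circle_through y y' x'" y y' "circle_through y y' x \<star> q"] 1 2 assms(5) by metis
  then show ?thesis using circle_eqv_eq 1 2 assms eqv_sym eqv_trans by metis
qed

text \<open>Equal values would give two circles sharing \<open>y\<close>, \<open>x\<close> and a
  point on \<open>q\<close>, hence equal, although they differ on the generator of \<open>w\<close>.
  This is the disagreement required by \<open>discordant_transposition\<close>.\<close>

lemma return_map_discordant1:
  assumes "y \<simeq> z" "y' \<simeq> w" "x \<simeq> p" "y'' \<simeq> w" "y' \<noteq> y''"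
  shows "return_map y y' x \<noteq> return_map y y'' x"
proof
  assume e: "return_map y y' x = return_map y y'' x"
  note 1 = circle_through[OF assms(1-3)] return_map_p[OF assms(1-3)] note 2 = circle_through[OF assms(1,4,3)] return_map_p[OF assms(1,4,3)]
  have "y \<noteq> x" using npar3 npar_ne assms by metis
  then have "circle_through y y' x = circle_through y y'' x"
    using circle3_unique[of "circle_through y y' x" "circle_through y y'' x" y x "circle_through y y' x \<star> q"] 1 2 e by metis
  then show False using circle_eqv_eq 1 2 assms eqv_sym eqv_trans by metis
qed

lemma return_map_discordant2:
  assumes "y \<simeq> z" "y' \<simeq> w" "x \<simeq> p" "y'' \<simeq> z" "y \<noteq> y''"
  shows "return_map y y' x \<noteq> return_map y'' y' x"
proof
  assume e: "return_map y y' x = return_map y'' y' x"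
  note 1 = circle_through[OF assms(1-3)] return_map_p[OF assms(1-3)] note 2 = circle_through[OF assms(4,2,3)] return_map_p[OF assms(4,2,3)]
  have "y' \<noteq> x" using npar3 npar_ne assms by metis
  then have "circle_through y y' x = circle_through y'' y' x"
    using circle3_unique[of "circle_through y y' x" "circle_through y'' y' x" y' x "circle_through y y' x \<star> q"] 1 2 e by metis
  then show False using circle_eqv_eq 1 2 assms eqv_sym eqv_trans by metis
qed

text \<open>On three points, an involution other than the identity is a transposition. Excluding the
  identity keeps the parity odd, which is what passes from one return map to the next.\<close>

definition transposes :: "('a \<Rightarrow> 'a) \<Rightarrow> bool" where
  "transposes g \<longleftrightarrow> g (g (K \<star> p)) = K \<star> p \<and> g (g (L \<star> p)) = L \<star> p \<and> g (g a) = a \<and>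
    (g (K \<star> p) \<noteq> K \<star> p \<or> g (L \<star> p) \<noteq> L \<star> p \<or> g a \<noteq> a)"

lemma gen_p: "K \<star> p \<simeq> p" "L \<star> p \<simeq> p" "a \<simeq> p"
  using pt_eqv K L pq_npar a by metis+

lemma return_map_mem3:
  assumes "y \<simeq> z" "y' \<simeq> w" "x \<simeq> p"
  shows "return_map y y' x \<in> {K \<star> p, L \<star> p, a}"
  using return_map_p(1)[OF assms] a(4) by blast

lemma return_map_ne3:
  assumes "y \<simeq> z" "y' \<simeq> w"
  shows "return_map y y' (K \<star> p) \<noteq> return_map y y' (L \<star> p)" "return_map y y' (K \<star> p) \<noteq> return_map y y' a"
    "return_map y y' (L \<star> p) \<noteq> return_map y y' a"
  using return_map_inj[OF assms] gen_p distinct6 a by metis+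

lemma transposes_step:
  assumes "y \<simeq> z" "y' \<simeq> w" "u \<simeq> z" "u' \<simeq> w" "transposes (return_map y y')"
    and "\<And>x. x \<simeq> p \<Longrightarrow> return_map u u' x \<noteq> return_map y y' x"
  shows "transposes (return_map u u')"
proof -
  have d: "K \<star> p \<noteq> L \<star> p" "K \<star> p \<noteq> a" "L \<star> p \<noteq> a" using distinct6 a by metis+
  show ?thesis
    using discordant_transposition[of "K \<star> p" "L \<star> p" a "return_map y y'" "return_map u u'", OF d
        return_map_mem3[OF assms(1,2) gen_p(1)] return_map_mem3[OF assms(1,2) gen_p(2)] return_map_mem3[OF assms(1,2) gen_p(3)]
        _ _ _ _ return_map_mem3[OF assms(3,4) gen_p(1)] return_map_mem3[OF assms(3,4) gen_p(2)]
        return_map_mem3[OF assms(3,4) gen_p(3)] return_map_ne3[OF assms(3,4)]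
        assms(6)[OF gen_p(1)] assms(6)[OF gen_p(2)] assms(6)[OF gen_p(3)]]
      assms(5) unfolding transposes_def by blast
qed

text \<open>\<open>K\<close> and \<open>L\<close> are two of the circles through \<open>z\<close>
  and \<open>w\<close>; they make the return map exchange \<open>K \<star> p\<close> and
  \<open>L \<star> p\<close>, and injectivity leaves \<open>a\<close> fixed.\<close>

lemma transposes_base: "transposes (return_map z w)"
proof -
  have e: "z \<simeq> z" "w \<simeq> w" using eqv_refl zw_facts npar_P by metis+
  have "circle_through z w (K \<star> p) = K" "circle_through z w (L \<star> p) = L"
    using circle_through_eq[OF e] gen_p K L zw_facts pt_mem pq_npar by metis+
  then have g: "return_map z w (K \<star> p) = L \<star> p" "return_map z w (L \<star> p) = K \<star> p" unfolding return_map_def by simp_all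
  moreover have "return_map z w a = a" using return_map_mem3[OF e gen_p(3)] return_map_ne3[OF e] g by auto
  ultimately show ?thesis unfolding transposes_def using distinct6 by simp
qed

text \<open>The pair \<open>z\<close>, \<open>w\<close> is changed one entry at a time, because
  disagreement at every point is known for pairs that share an entry.\<close>

lemma transposes_return_map:
  assumes y: "y \<simeq> z" "y' \<simeq> w"
  shows "transposes (return_map y y')"
proof -
  have e: "z \<simeq> z" "w \<simeq> w" using eqv_refl zw_facts npar_P by metis+
  have 1: "transposes (return_map z y')"
  proof (cases "y' = w")
    case True then show ?thesis using transposes_base by simp
  next
    case False
    then show ?thesis
      using transposes_step[OF e e(1) y(2) transposes_base] return_map_discordant1[OF e(1) y(2) _ e(2)] by blast
  qed
  show ?thesis
  proof (cases "y = z")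
    case True then show ?thesis using 1 by simp
  next
    case False
    then show ?thesis
      using transposes_step[OF e(1) y(2) y 1] return_map_discordant2[OF y _ e(1)] by blast
  qed
qed

lemma reflect_circle:
  assumes M: "M \<in> C"
  shows "\<exists>M'\<in>C. \<forall>s\<in>M. reflect s \<in> M'"
proof -
  have P: "z \<in> P" "w \<in> P" using zw_facts npar_P by metis+
  have e: "M \<star> z \<simeq> z" "M \<star> w \<simeq> w" "M \<star> p \<simeq> p" "M \<star> q \<simeq> q" using pt_eqv M P pq_npar by metis+
  have m: "M \<star> z \<in> M" "M \<star> w \<in> M" "M \<star> p \<in> M" using pt_mem M P pq_npar by metis+
  let ?g = "return_map (M \<star> z) (M \<star> w)"
  have "circle_through (M \<star> z) (M \<star> w) (M \<star> p) = M" using circle_through_eq e M m by metis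
  then have g: "?g (M \<star> p) = reflect (M \<star> q)" unfolding return_map_def by simp
  have "?g (?g (M \<star> p)) = M \<star> p"
    using transposes_return_map[OF e(1,2)] a(4)[OF e(3)] unfolding transposes_def by metis
  then have g': "?g (reflect (M \<star> q)) = M \<star> p" using g by simp
  \<comment> \<open>The expected image of \<open>M\<close>. It contains the fixed points
    \<open>M \<star> z\<close>, \<open>M \<star> w\<close> and the reflection of
    \<open>M \<star> q\<close> by construction; \<open>g'\<close> places the reflection of
    \<open>M \<star> p\<close> on it.\<close>
  let ?N = "circle_through (M \<star> z) (M \<star> w) (reflect (M \<star> q))"
  note N = circle_through[OF e(1,2) reflect_q[OF e(4)]] return_map_p[OF e(1,2) reflect_q[OF e(4)]]
  have "reflect s \<in> ?N" if s: "s \<in> M" for s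
  proof -
    have sP: "s \<in> P" using s circle_sub M by metis
    then consider "s \<simeq> p" | "s \<simeq> q" | "s \<simeq> z" | "s \<simeq> w" using all by blast
    then show ?thesis
    proof cases
      case 1 then show ?thesis using N g' pt_unique M s by metis
    next
      case 2 then show ?thesis using N pt_unique M s by metis
    next
      case 3
      then have "reflect s = s" using reflect_other npar_cong1 zw_facts by metis
      then show ?thesis using N 3 pt_unique M s by metis
    next
      case 4
      then have "reflect s = s" using reflect_other npar_cong1 zw_facts by metis
      then show ?thesis using N 4 pt_unique M s by metis
    qed
  qed
  then show ?thesis using N by blast
qed

lemma reflect_invariant:
  assumes M: "M \<in> C" "t \<in> M" "reflect t \<in> M" "reflect t \<noteq> t" and s: "s \<in> M"
  shows "reflect s \<in> M"
proof -
  have P: "t \<in> P" "s \<in> P" using M s circle_sub by metis+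
  have t: "t \<simeq> p \<or> t \<simeq> q" using M cases4 P reflect_other by metis
  have "\<exists>u\<in>M. \<exists>v\<in>M. u \<simeq> p \<and> v \<simeq> q \<and> reflect u = v \<and> reflect v = u"
    using t M reflect_p reflect_q reflect_reflect P by metis
  then obtain u v where u: "u \<in> M" "v \<in> M" "u \<simeq> p" "v \<simeq> q" "reflect u = v" "reflect v = u" by blast
  from P(2) show ?thesis
  proof (cases rule: cases4)
    case 1
    then have "s = u" using u s M circle_eqv_eq eqv_sym eqv_trans by metis
    then show ?thesis using u by metis
  next
    case 2
    then have "s = v" using u s M circle_eqv_eq eqv_sym eqv_trans by metis
    then show ?thesis using u by metis
  next
    case 3
    then show ?thesis using reflect_other s by metis
  qed
qed

lemma reflect_K:
  assumes "x \<in> K"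
  shows "reflect x = xKL C x K L"
proof -
  have P: "x \<in> P" using circle_sub K assms by metis
  have *: "xKL C (K \<star> r) K L = L \<star> r'" if r: "swapped r r'" for r r'
  proof -
    obtain V where V: "V \<in> C" "tangent_at V K (K \<star> r)" "tangent_at V L (L \<star> r')"
      using swapped_circle r by metis
    show ?thesis
      using xKL_eq[of "K \<star> r" V] V pt_mem K r swapped_npar swapped_not_fixed fixed_iff by metis
  qed
  from P show ?thesis
  proof (cases rule: cases4)
    case 1
    then have "x = K \<star> p" using pt_unique assms K by metis
    then show ?thesis using *[OF spq] by simp
  next
    case 2
    then have "x = K \<star> q" using pt_unique assms K by metis
    then show ?thesis using *[OF swapped_sym[OF spq]] by simp
  next
    case 3
    then have "x = z \<or> x = w" using all P not_npar_eqv circle_eqv_eq K assms zw_facts by metis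
    then have "x \<in> L" using zw_facts by metis
    then show ?thesis using reflect_other[OF 3] unfolding xKL_def by simp
  qed
qed

end

context two_circles
begin

text \<open>Mapping circles into circles suffices: applying the involution twice puts
  \<open>M\<close> inside a circle \<open>M''\<close>, comparable circles are equal, and so both
  inclusions become equalities.\<close>

lemma automorphism_if:
  assumes P: "\<And>x. x \<in> P \<Longrightarrow> f x \<in> P" and inv: "\<And>x. x \<in> P \<Longrightarrow> f (f x) = x"
    and circ: "\<And>M. M \<in> C \<Longrightarrow> \<exists>M'\<in>C. \<forall>s\<in>M. f s \<in> M'"
    and stable: "\<And>M t s. M \<in> C \<Longrightarrow> t \<in> M \<Longrightarrow> f t \<in> M \<Longrightarrow> f t \<noteq> t \<Longrightarrow> s \<in> M \<Longrightarrow> f s \<in> M"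
    and KL: "\<And>x. x \<in> K \<Longrightarrow> f x = xKL C x K L"
  shows "automorphism P C f \<and> involutory P f \<and> (\<forall>x\<in>K. f x = xKL C x K L) \<and>
    (\<forall>x\<in>P. f x \<noteq> x \<longrightarrow> (\<forall>M\<in>C. x \<in> M \<and> f x \<in> M \<longrightarrow> f ` M = M))"
proof -
  have ff: "f ` f ` M = M" if "M \<in> C" for M
    using inv circle_sub[OF that] by (force simp: image_image)
  have img: "f ` M \<in> C" if M: "M \<in> C" for M
  proof -
    obtain M' where M': "M' \<in> C" "f ` M \<subseteq> M'" using circ M by blast
    obtain M'' where M'': "M'' \<in> C" "f ` M' \<subseteq> M''" using circ M' by blast
    have "M \<subseteq> M''" using ff[OF M] M' M'' by blast
    then have "f ` M' \<subseteq> M" using circle_subset_eq M M'' by metis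
    then have "f ` M = M'" using ff[OF M'(1)] M' by blast
    then show ?thesis using M' by simp
  qed
  have "bij_betw f P P"
    by (rule bij_betw_byWitness[where f' = f]) (use P inv in auto)
  moreover have "(`) f ` C = C"
  proof
    show "(`) f ` C \<subseteq> C" using img by blast
    show "C \<subseteq> (`) f ` C"
    proof
      fix M assume M: "M \<in> C"
      then have "f ` f ` M \<in> (`) f ` C" using img by blast
      then show "M \<in> (`) f ` C" using ff M by simp
    qed
  qed
  ultimately have "automorphism P C f" unfolding automorphism_def by simp
  moreover have "involutory P f" unfolding involutory_def using inv by blast
  moreover have "f ` M = M" if "M \<in> C" "x \<in> M" "f x \<in> M" "f x \<noteq> x" for M x
  proof -
    have "f ` M \<subseteq> M" using stable[OF that] by blast
    then show ?thesis using ff[OF that(1)] by blast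
  qed
  ultimately show ?thesis using KL by blast
qed

lemma involution_exists:
  "\<exists>f. automorphism P C f \<and> involutory P f \<and> (\<forall>x\<in>K. f x = xKL C x K L) \<and>
    (\<forall>x\<in>P. f x \<noteq> x \<longrightarrow> (\<forall>M\<in>C. x \<in> M \<and> f x \<in> M \<longrightarrow> f ` M = M))"
proof (cases "\<forall>p q. swapped p q \<longrightarrow> (\<exists>l l'. swapped l l' \<and> l \<sharp> p \<and> l \<sharp> q)")
  case True
  interpret two_circles_many P C par K L by unfold_locales (use True in blast)
  show ?thesis
  proof (rule exI[of _ reflect], rule automorphism_if)
    show "reflect s \<in> M" if "M \<in> C" "t \<in> M" "reflect t \<in> M" "reflect t \<noteq> t" "s \<in> M" for M t s
      using reflect_invariant that reflect_fixed by metis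
  qed (use reflect_P reflect_reflect reflect_circle reflect_K in auto)
next
  case False
  then obtain p q where pq: "swapped p q" "\<And>l l'. swapped l l' \<Longrightarrow> l \<sharp> p \<Longrightarrow> l \<sharp> q \<Longrightarrow> False" by blast
  note n = swapped_npar[OF pq(1)]
  have fx: "fixed x" if "x \<sharp> p" "x \<sharp> q" for x using swapped_exists pq(2) that npar_P by metis
  obtain M c1 c2 c3 where M: "M \<in> C" "c1 \<in> M" "c2 \<in> M" "c3 \<in> M" "c1 \<noteq> c2" "c2 \<noteq> c3" "c1 \<noteq> c3"
    using ax_rich by blast
  \<comment> \<open>Of three points of \<open>M\<close> at least one lies off the generators of
    \<open>p\<close> and \<open>q\<close>; its generator is fixed and supplies a first common point
    of \<open>K\<close> and \<open>L\<close>.\<close>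
  have "\<exists>c\<in>M. c \<noteq> M \<star> p \<and> c \<noteq> M \<star> q" using M by metis
  then obtain c where c: "c \<in> M" "c \<noteq> M \<star> p" "c \<noteq> M \<star> q" by blast
  have cP: "c \<in> P" using c circle_sub M by metis
  have "c \<sharp> p" "c \<sharp> q" using c pt_unique M eqv_or_npar cP n by metis+
  then have "fixed c" using fx by metis
  then have zL: "K \<star> c \<in> L" using fixed_iff cP by metis
  have zK: "K \<star> c \<in> K" using pt_mem K cP by metis
  have "K \<noteq> L" using not_tan tan_refl zK by metis
  then obtain w where zw: "K \<inter> L = {K \<star> c, w}" using int_pair[of K L "K \<star> c"] K L zK zL by metis
  \<comment> \<open>Every further generator is fixed, thus carries a point of
    \<open>K \<inter> L\<close>, which has only the points \<open>K \<star> c\<close> and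
    \<open>w\<close>.\<close>
  have all: "x \<simeq> p \<or> x \<simeq> q \<or> x \<simeq> K \<star> c \<or> x \<simeq> w" if x: "x \<in> P" for x
  proof (rule ccontr)
    assume neg: "\<not> ?thesis"
    then have "fixed x" using fx eqv_or_npar x n by metis
    then have "K \<star> x \<in> K \<inter> L" using fixed_iff x pt_mem K by blast
    then have "K \<star> x = K \<star> c \<or> K \<star> x = w" using zw by blast
    then show False using neg pt_eqv K x eqv_sym by metis
  qed
  obtain a where a: "a \<simeq> p" "a \<noteq> K \<star> p" "a \<noteq> L \<star> p"
    "\<forall>x. x \<simeq> p \<longrightarrow> x = K \<star> p \<or> x = L \<star> p \<or> x = a"
    using third_point[OF pq(1) zw all] by blast
  obtain b where b: "b \<simeq> q" "b \<noteq> K \<star> q" "b \<noteq> L \<star> q"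
    "\<forall>x. x \<simeq> q \<longrightarrow> x = K \<star> q \<or> x = L \<star> q \<or> x = b"
    using third_point[OF swapped_sym[OF pq(1)] zw] all by blast
  interpret two_circles_few P C par K L p q a b "K \<star> c" w
    by unfold_locales (use pq(1) zw all a b in blast)+
  show ?thesis
  proof (rule exI[of _ reflect], rule automorphism_if)
    show "reflect s \<in> M" if "M \<in> C" "t \<in> M" "reflect t \<in> M" "reflect t \<noteq> t" "s \<in> M" for M t s
      using reflect_invariant that by metis
  qed (use reflect_P reflect_reflect reflect_circle reflect_K in auto)
qed

end

theorem theorem3p1:
  fixes P :: "'p set" and C :: "'p set set" and par :: "'p \<Rightarrow> 'p \<Rightarrow> bool"
    and K L :: "'p set"
  assumes "laguerre_plane P C par"
    and "axiom_C P C"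
    and "axiom_S P C par"
    and "K \<in> C" and "L \<in> C"
    and "\<not> tangent K L"
  shows "\<exists>\<phi>. automorphism P C \<phi> \<and> involutory P \<phi> \<and>
           (\<forall>x\<in>K. \<phi> x = xKL C x K L) \<and>
           (\<forall>x\<in>P. \<phi> x \<noteq> x \<longrightarrow> (\<forall>M\<in>C. x \<in> M \<and> \<phi> x \<in> M \<longrightarrow> \<phi> ` M = M))"
proof -
  interpret two_circles P C par K L by unfold_locales (use assms in auto)
  show ?thesis by (rule involution_exists)
qed

end
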